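(* Let $\nu,x\geq 0$ be real numbers with $I_\nu(x)\neq 0$ (i.e. $x>0$ or $\nu=0$), let $\alpha_0=-\log(\sqrt2-1)$, and let $H(\nu,x)=\sum_{k=1}^{\infty}\frac{I_{\nu+k}(x)}{I_\nu(x)}$. Then: (1) For all such $\nu,x$ (and in particular when $[\nu]+2>[x]$), $$F(\nu+1,x)\bigl(1+F(\nu+2,x)\bigr)\leq H(\nu,x)\leq \frac{F\left(\nu+\frac12,x\right)}{1-F\left(\nu+\frac32,x\right)}.$$ (2) If $[\nu]+2\leq [x]$, then $\mathcal{L}(\nu,x)\leq H(\nu,x)\leq \mathcal{U}(\nu,x)$, where $$\mathcal{L}(\nu,x)=\frac{2x\,e^{-\frac1x(\nu+1)}}{\nu+\frac32+\sqrt{\left(\nu+\frac32\right)^2+4x}}-\frac{2x\,e^{-\frac{1}{2x}([x]-\nu-\nu_f+1)([x]+\nu-\nu_f+2)}}{[x]+\frac32+\sqrt{\left([x]+\frac32\right)^2+\frac{8x}{\pi}}}+e^{-\frac{([x]-[\nu]-1)([x]+\nu+\nu_f)}{2x}}F([x]+\nu_f,x)\bigl(1+F([x]+\nu_f+1,x)\bigr)$$ and $$\mathcal{U}(\nu,x)=\frac{2x}{\alpha_0}\left[\frac{1}{\nu+\sqrt{\nu^2+\frac{8x}{\pi\alpha_0}}}-\frac{e^{-\frac{\alpha_0}{2x}(x^2-\nu^2)}}{x+\sqrt{x^2+\frac{4x}{\alpha_0}}}\right]+e^{-\frac{\alpha_0}{2x}([x]-[\nu]-1)([x]+\nu+\n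u_f-1)}\,\frac{F\left([x]+\nu_f-\frac12,x\right)}{1-F\left([x]+\nu_f+\frac12,x\right)}.$$
   Context: $I_\nu$ denotes the modified Bessel function of the first kind, $I_{\nu}(x)=\sum_{k=0}^{\infty}\frac{1}{k!\,\Gamma(k+\nu+1)}\left(\frac{x}{2}\right)^{2k+\nu}$. For a real number $y\ge 0$, $[y]$ denotes the floor of $y$ and $y_f=y-[y]$ its fractional part, so $\nu_f=\nu-[\nu]$. The function $F$ is $F(\nu,x)=\frac{x}{\nu+\sqrt{\nu^2+x^2}}$. $\log$ is the natural logarithm. *)

theory Defs
  imports "HOL-Analysis.Analysis"
begin

text \<open>
  The real power \<open>x powr a\<close> of the library satisfies \<open>0 powr 0 = 0\<close>. The leading term of the
  series of \<open>I\<^sub>0\<close> at the origin needs the convention \<open>0\<^sup>0 = 1\<close>, so that \<open>I\<^sub>0(0) = 1\<close>.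
\<close>

definition real_pow :: "real \<Rightarrow> real \<Rightarrow> real" where
  "real_pow x a = (if a = 0 then 1 else x powr a)"

definition bessel_I :: "real \<Rightarrow> real \<Rightarrow> real" where
  "bessel_I \<nu> x =
     (\<Sum>k. 1 / (fact k * Gamma (real k + \<nu> + 1)) * real_pow (x / 2) (2 * real k + \<nu>))"

definition bessel_H :: "real \<Rightarrow> real \<Rightarrow> real" where
  "bessel_H \<nu> x = (\<Sum>k. bessel_I (\<nu> + real (Suc k)) x / bessel_I \<nu> x)"

definition bessel_F :: "real \<Rightarrow> real \<Rightarrow> real" where
  "bessel_F \<nu> x = x / (\<nu> + sqrt (\<nu>\<^sup>2 + x\<^sup>2))"

definition alpha0 :: real where
  "alpha0 = - ln (sqrt 2 - 1)"

definition lower_L :: "real \<Rightarrow> real \<Rightarrow> real" where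
  "lower_L \<nu> x =
     2 * x * exp (- (1 / x) * (\<nu> + 1)) / (\<nu> + 3/2 + sqrt ((\<nu> + 3/2)\<^sup>2 + 4 * x))
     - 2 * x * exp (- (1 / (2 * x)) * (of_int \<lfloor>x\<rfloor> - \<nu> - frac \<nu> + 1) * (of_int \<lfloor>x\<rfloor> + \<nu> - frac \<nu> + 2))
         / (of_int \<lfloor>x\<rfloor> + 3/2 + sqrt ((of_int \<lfloor>x\<rfloor> + 3/2)\<^sup>2 + 8 * x / pi))
     + exp (- ((of_int \<lfloor>x\<rfloor> - of_int \<lfloor>\<nu>\<rfloor> - 1) * (of_int \<lfloor>x\<rfloor> + \<nu> + frac \<nu>)) / (2 * x))
         * bessel_F (of_int \<lfloor>x\<rfloor> + frac \<nu>) x * (1 + bessel_F (of_int \<lfloor>x\<rfloor> + frac \<nu> + 1) x)"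

definition upper_U :: "real \<Rightarrow> real \<Rightarrow> real" where
  "upper_U \<nu> x =
     2 * x / alpha0 *
       (1 / (\<nu> + sqrt (\<nu>\<^sup>2 + 8 * x / (pi * alpha0)))
        - exp (- (alpha0 / (2 * x)) * (x\<^sup>2 - \<nu>\<^sup>2)) / (x + sqrt (x\<^sup>2 + 4 * x / alpha0)))
     + exp (- (alpha0 / (2 * x)) * (of_int \<lfloor>x\<rfloor> - of_int \<lfloor>\<nu>\<rfloor> - 1) * (of_int \<lfloor>x\<rfloor> + \<nu> + frac \<nu> - 1))
         * (bessel_F (of_int \<lfloor>x\<rfloor> + frac \<nu> - 1/2) x / (1 - bessel_F (of_int \<lfloor>x\<rfloor> + frac \<nu> + 1/2) x))"

end

theory Submission
  imports Defs "HOL-Probability.Distributions"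
begin

text \<open>
  The ratio \<open>r = I\<^bsub>\<nu>+1\<^esub> / I\<^bsub>\<nu>\<^esub>\<close> solves the Riccati equation \<open>r' = 1 - (2\<nu> + 1) r / x - r\<^sup>2\<close> with
  \<open>r(0) = 0\<close>, and \<open>F(\<nu> + 1, x)\<close> and \<open>F(\<nu> + 1/2, x)\<close> are a sub- and a supersolution; this gives Amos'
  bounds \<open>F(\<nu> + 1, x) \<le> r \<le> F(\<nu> + 1/2, x)\<close>. Since \<open>H\<close> is a sum of products of such ratios, part (1)
  follows by truncation from below and a geometric series from above. For part (2), the identity
  \<open>F(\<nu>, x) = exp (- arsinh (\<nu> / x))\<close> together with \<open>\<alpha>\<^sub>0 t \<le> arsinh t \<le> t\<close> on \<open>[0, 1]\<close> bounds the products
  by Gaussians in the summation index. The first \<open>\<lfloor>x\<rfloor> - \<lfloor>\<nu>\<rfloor> - 1\<close> terms are compared with a Gaussian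
  integral, which is estimated by Mills ratio bounds, and the remaining tail is a multiple of
  \<open>H(\<lfloor>x\<rfloor> + \<nu>\<^sub>f - 1, x)\<close>, to which part (1) applies.
\<close>

subsection \<open>Bounds for the ratio of consecutive Bessel functions\<close>

text \<open>If \<open>w x < 0\<close>, take the last point \<open>z\<close> of \<open>[0, x]\<close>
  with \<open>w z \<ge> 0\<close>. Between \<open>z\<close> and \<open>x\<close> the function is
  negative, hence nondecreasing, so \<open>w x \<ge> w z\<close>. Derivatives are asked for at
  \<open>t > 0\<close> only, since the Riccati equation is singular at 0.\<close>

lemma nonneg_of_deriv_nonneg_when_neg:
  fixes w w' :: "real \<Rightarrow> real"
  assumes w0: "w 0 \<ge> 0" and cont: "continuous_on {0..} w"
    and der: "\<And>t. t > 0 \<Longrightarrow> (w has_real_derivative w' t) (at t)"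
    and nonneg: "\<And>t. t > 0 \<Longrightarrow> w t < 0 \<Longrightarrow> w' t \<ge> 0"
    and x: "x \<ge> 0"
  shows "w x \<ge> 0"
proof (rule ccontr)
  assume "\<not> w x \<ge> 0"
  then have neg: "w x < 0" by simp
  define S where "S = {t \<in> {0..x}. w t \<ge> 0}"
  have "closed S"
    unfolding S_def
    by (rule continuous_on_closed_Collect_le)
       (auto intro: continuous_on_subset[OF cont])
  moreover have "bounded S" unfolding S_def by (rule bounded_subset[of "{0..x}"]) auto
  moreover have "S \<noteq> {}" using w0 x by (auto simp: S_def intro!: exI[of _ 0])
  ultimately obtain z where z: "z \<in> S" "\<And>t. t \<in> S \<Longrightarrow> t \<le> z"
    using compact_attains_sup[of S] by (auto simp: compact_eq_bounded_closed)
  have zx: "0 \<le> z" "z < x" "w z \<ge> 0"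
    using z(1) neg by (auto simp: S_def order.order_iff_strict)
  have "w z \<le> w x"
  proof (rule DERIV_nonneg_imp_increasing_open[of z x w])
    show "z \<le> x" using zx by simp
    show "continuous_on {z..x} w" using zx by (auto intro: continuous_on_subset[OF cont])
    fix t assume t: "z < t" "t < x"
    then have "t \<notin> S" using z(2) by force
    then have "w t < 0" using t zx by (auto simp: S_def)
    then show "\<exists>y. (w has_real_derivative y) (at t) \<and> y \<ge> 0"
      using der[of t] nonneg[of t] t zx by auto
  qed
  then show False using zx neg by simp
qed

section \<open>The power series left after removing the fractional power\<close>

text \<open>Chosen so that \<open>bessel_I \<nu> x = (x / 2) powr \<nu> * bessel_phi \<nu>
  (x\<^sup>2 / 4)\<close> for \<open>x > 0\<close>; it is entire in \<open>t\<close>, so it can be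
  differentiated termwise.\<close>

definition bessel_phi :: "real \<Rightarrow> real \<Rightarrow> real" where
  "bessel_phi \<nu> t = (\<Sum>k. 1 / (fact k * Gamma (real k + \<nu> + 1)) * t ^ k)"

text \<open>Each unit step from \<open>\<nu> + 1 \<ge> 1\<close> multiplies Gamma by a factor at
  least 1. This lets the exponential series dominate \<open>bessel_phi\<close>.\<close>

lemma Gamma_shift_mono:
  fixes \<nu> :: real
  assumes "\<nu> \<ge> 0"
  shows "Gamma (\<nu> + 1) \<le> Gamma (real k + \<nu> + 1)"
proof (induction k)
  case (Suc k)
  have pos: "Gamma (real k + \<nu> + 1) > 0" using assms by (intro Gamma_real_pos) auto
  have "Gamma (real (Suc k) + \<nu> + 1) = (real k + \<nu> + 1) * Gamma (real k + \<nu> + 1)"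
    using assms Gamma_plus1[of "real k + \<nu> + 1"]
    by (simp add: add_ac nonpos_Ints_def)
  also have "\<dots> \<ge> 1 * Gamma (real k + \<nu> + 1)"
    using assms pos by (intro mult_right_mono) auto
  finally show ?case using Suc by simp
qed simp

lemma bessel_phi_summable:
  assumes "\<nu> \<ge> 0"
  shows "summable (\<lambda>k. 1 / (fact k * Gamma (real k + \<nu> + 1)) * (t::real) ^ k)"
proof (rule summable_comparison_test')
  show "summable (\<lambda>k. 1 / Gamma (\<nu> + 1) * (inverse (fact k) * \<bar>t\<bar> ^ k))"
    by (intro summable_mult summable_exp)
  fix k :: nat
  have pos: "Gamma (\<nu> + 1) > 0" using assms by (intro Gamma_real_pos) auto
  note le = Gamma_shift_mono[OF assms, of k]
  have "norm (1 / (fact k * Gamma (real k + \<nu> + 1)) * t ^ k)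
        = 1 / Gamma (real k + \<nu> + 1) * (inverse (fact k) * \<bar>t\<bar> ^ k)"
    using le pos by (simp add: abs_mult power_abs divide_simps)
  also have "\<dots> \<le> 1 / Gamma (\<nu> + 1) * (inverse (fact k) * \<bar>t\<bar> ^ k)"
    using le pos by (intro mult_right_mono divide_left_mono) auto
  finally show "norm (1 / (fact k * Gamma (real k + \<nu> + 1)) * t ^ k)
        \<le> 1 / Gamma (\<nu> + 1) * (inverse (fact k) * \<bar>t\<bar> ^ k)" .
qed

lemma bessel_phi_pos:
  assumes "\<nu> \<ge> 0" "t \<ge> 0"
  shows "bessel_phi \<nu> t > 0"
proof -
  have G: "Gamma (real k + \<nu> + 1) > 0" for k using assms by (intro Gamma_real_pos) auto
  show ?thesis
    unfolding bessel_phi_def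
  proof (rule suminf_pos2[where i = 0])
    show "summable (\<lambda>k. 1 / (fact k * Gamma (real k + \<nu> + 1)) * t ^ k)"
      by (rule bessel_phi_summable[OF assms(1)])
    show "0 \<le> 1 / (fact k * Gamma (real k + \<nu> + 1)) * t ^ k" for k
      using G[of k] assms by (intro mult_nonneg_nonneg divide_nonneg_nonneg) auto
    show "0 < 1 / (fact 0 * Gamma (real 0 + \<nu> + 1)) * t ^ 0" using G[of 0] by simp
  qed
qed

text \<open>The factor \<open>k + 1\<close> from differentiation cancels against the factorial,
  while the index shift raises the Gamma argument by one.\<close>

lemma bessel_phi_has_real_derivative:
  assumes "\<nu> \<ge> 0"
  shows "(bessel_phi \<nu> has_real_derivative bessel_phi (\<nu> + 1) t) (at t)"
proof -
  let ?c = "\<lambda>\<nu> k. 1 / (fact k * Gamma (real k + \<nu> + 1))"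
  have "diffs (?c \<nu>) k = ?c (\<nu> + 1) k" for k
  proof -
    have "real k + \<nu> + 2 > 0" using assms by simp
    then have "Gamma (real k + \<nu> + 2) \<noteq> 0" using Gamma_real_pos[of "real k + \<nu> + 2"] by linarith
    then show ?thesis by (simp add: diffs_def add_ac divide_simps)
  qed
  then show ?thesis
    using termdiffs_strong_converges_everywhere[OF bessel_phi_summable[OF assms], of t]
    by (simp add: bessel_phi_def[abs_def])
qed

text \<open>Coefficientwise this is \<open>k + \<nu> + 2 = (\<nu> + 1) + (k + 1)\<close>. It is the
  three-term recurrence relating the Bessel functions of orders \<open>\<nu>\<close>,
  \<open>\<nu> + 1\<close> and \<open>\<nu> + 2\<close>.\<close>

lemma bessel_phi_recurrence:
  assumes "\<nu> \<ge> 0"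
  shows "bessel_phi \<nu> t = (\<nu> + 1) * bessel_phi (\<nu> + 1) t + t * bessel_phi (\<nu> + 2) t"
proof -
  let ?c = "\<lambda>\<nu> k. 1 / (fact k * Gamma (real k + \<nu> + 1))"
  have s: "summable (\<lambda>k. ?c \<nu>' k * t ^ k)" if "\<nu>' \<ge> 0" for \<nu>'
    using bessel_phi_summable[OF that] .
  have sS: "summable (\<lambda>k. ?c (\<nu> + 1) (Suc k) * t ^ Suc k)"
    using assms by (intro iffD2[OF summable_Suc_iff] s) simp
  have G: "Gamma (real k + \<nu> + 2) = (real k + \<nu> + 1) * Gamma (real k + \<nu> + 1)"
          "Gamma (real k + \<nu> + 1) > 0" for k
    using assms Gamma_plus1[of "real k + \<nu> + 1"]
    by (auto simp: add_ac nonpos_Ints_def intro!: Gamma_real_pos)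
  have coeff: "?c \<nu> (Suc k) = (\<nu> + 1) * ?c (\<nu> + 1) (Suc k) + ?c (\<nu> + 2) k" for k
  proof -
    have f: "fact (Suc k) = (real k + 1) * fact k" by simp
    have g: "Gamma (real (Suc k) + (\<nu> + 1) + 1) = (real k + \<nu> + 2) * Gamma (real k + \<nu> + 2)"
      using G(1)[of "Suc k"] by (simp add: add_ac)
    have p: "Gamma (real k + \<nu> + 2) > 0" using G(2)[of "Suc k"] by (simp add: add_ac)
    have r: "real (Suc k) + \<nu> + 1 = real k + \<nu> + 2" "real k + (\<nu> + 2) + 1 = real (Suc k) + (\<nu> + 1) + 1"
      by simp_all
    show ?thesis unfolding f r g using p assms
      by (simp add: divide_simps del: of_nat_Suc)
  qed
  have c0: "?c \<nu> 0 = (\<nu> + 1) * ?c (\<nu> + 1) 0"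
    using G(1)[of 0] assms by (simp add: add_ac)
  have "bessel_phi \<nu> t = ?c \<nu> 0 + (\<Sum>k. ?c \<nu> (Suc k) * t ^ Suc k)"
    using suminf_split_head[OF s[OF assms]] by (simp add: bessel_phi_def)
  also have "(\<Sum>k. ?c \<nu> (Suc k) * t ^ Suc k) =
     (\<Sum>k. (\<nu> + 1) * (?c (\<nu> + 1) (Suc k) * t ^ Suc k) + t * (?c (\<nu> + 2) k * t ^ k))"
    unfolding coeff by (simp add: algebra_simps)
  also have "\<dots> = (\<Sum>k. (\<nu> + 1) * (?c (\<nu> + 1) (Suc k) * t ^ Suc k)) + (\<Sum>k. t * (?c (\<nu> + 2) k * t ^ k))"
    using assms by (intro suminf_add[symmetric] summable_mult sS s) simp
  also have "(\<Sum>k. t * (?c (\<nu> + 2) k * t ^ k)) = t * bessel_phi (\<nu> + 2) t"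
    unfolding bessel_phi_def using assms by (intro suminf_mult s) simp
  also have "(\<Sum>k. (\<nu> + 1) * (?c (\<nu> + 1) (Suc k) * t ^ Suc k))
       = (\<nu> + 1) * (\<Sum>k. ?c (\<nu> + 1) (Suc k) * t ^ Suc k)"
    by (intro suminf_mult sS)
  also have "(\<Sum>k. ?c (\<nu> + 1) (Suc k) * t ^ Suc k) = bessel_phi (\<nu> + 1) t - ?c (\<nu> + 1) 0"
    using suminf_split_head[OF s[of "\<nu> + 1"]] assms by (simp add: bessel_phi_def)
  finally show ?thesis using c0 by (simp add: algebra_simps)
qed

lemma bessel_I_eq_phi:
  assumes "\<nu> \<ge> 0" "x > 0"
  shows "bessel_I \<nu> x = (x / 2) powr \<nu> * bessel_phi \<nu> (x\<^sup>2 / 4)"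
proof -
  have "real_pow (x / 2) (2 * real k + \<nu>) = (x / 2) powr \<nu> * (x\<^sup>2 / 4) ^ k" for k
  proof -
    have "(x / 2) powr (2 * real k) = (x\<^sup>2 / 4) ^ k"
      using assms powr_realpow[of "x / 2" "2 * k"] by (simp add: power_mult power_divide)
    then show ?thesis
      using assms by (auto simp: real_pow_def powr_add add_nonneg_eq_0_iff)
  qed
  then have "bessel_I \<nu> x =
      (\<Sum>k. (x / 2) powr \<nu> * (1 / (fact k * Gamma (real k + \<nu> + 1)) * (x\<^sup>2 / 4) ^ k))"
    by (simp add: bessel_I_def mult_ac)
  also have "\<dots> = (x / 2) powr \<nu> * bessel_phi \<nu> (x\<^sup>2 / 4)"
    unfolding bessel_phi_def by (intro suminf_mult bessel_phi_summable assms)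
  finally show ?thesis .
qed

lemma bessel_I_pos: "\<nu> \<ge> 0 \<Longrightarrow> x > 0 \<Longrightarrow> bessel_I \<nu> x > 0"
  by (simp add: bessel_I_eq_phi bessel_phi_pos)

lemma bessel_I_zero:
  assumes "\<nu> > 0"
  shows "bessel_I \<nu> 0 = 0"
proof -
  have "real_pow 0 (2 * real k + \<nu>) = 0" for k
    using assms by (simp add: real_pow_def add_nonneg_eq_0_iff)
  then show ?thesis by (simp add: bessel_I_def)
qed

section \<open>The ratio of consecutive Bessel functions and its Riccati equation\<close>

text \<open>Written through \<open>bessel_phi\<close>, whose values are positive, so that the ratio
  is continuous at 0 even where \<open>bessel_I \<nu> 0\<close> vanishes.\<close>

definition bessel_ratio :: "real \<Rightarrow> real \<Rightarrow> real" where
  "bessel_ratio \<nu> x = x / 2 * bessel_phi (\<nu> + 1) (x\<^sup>2 / 4) / bessel_phi \<nu> (x\<^sup>2 / 4)"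

lemma bessel_I_Suc:
  assumes "\<nu> \<ge> 0" "x > 0"
  shows "bessel_I (\<nu> + 1) x = bessel_ratio \<nu> x * bessel_I \<nu> x"
proof -
  have "bessel_phi \<nu> (x\<^sup>2 / 4) > 0" using assms by (intro bessel_phi_pos) auto
  then show ?thesis using assms by (simp add: bessel_I_eq_phi bessel_ratio_def powr_add)
qed

lemma bessel_ratio_nonneg:
  assumes "\<nu> \<ge> 0" "x \<ge> 0"
  shows "bessel_ratio \<nu> x \<ge> 0"
  using bessel_phi_pos[of \<nu> "x\<^sup>2/4"] bessel_phi_pos[of "\<nu> + 1" "x\<^sup>2/4"] assms
  by (simp add: bessel_ratio_def)

lemma bessel_ratio_riccati:
  assumes "\<nu> \<ge> 0" "x > 0"
  shows "(bessel_ratio \<nu> has_real_derivative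
           1 - (2 * \<nu> + 1) / x * bessel_ratio \<nu> x - (bessel_ratio \<nu> x)\<^sup>2) (at x)"
proof -
  let ?t = "x\<^sup>2 / 4"
  define a b c where "a = bessel_phi \<nu> ?t" and "b = bessel_phi (\<nu> + 1) ?t"
    and "c = bessel_phi (\<nu> + 2) ?t"
  have a: "a > 0" unfolding a_def using assms by (intro bessel_phi_pos) auto
  have d: "((\<lambda>x. bessel_phi \<nu>' (x\<^sup>2 / 4)) has_real_derivative
               bessel_phi (\<nu>' + 1) ?t * (x / 2)) (at x)" if "\<nu>' \<ge> 0" for \<nu>'
    by (rule DERIV_chain'[OF _ bessel_phi_has_real_derivative[OF that], of "\<lambda>x. x\<^sup>2 / 4" "x / 2"])
       (auto intro!: derivative_eq_intros)
  have d0: "((\<lambda>x. bessel_phi \<nu> (x\<^sup>2 / 4)) has_real_derivative b * (x / 2)) (at x)"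
    using d[OF assms(1)] by (simp add: b_def)
  have d1: "((\<lambda>x. bessel_phi (\<nu> + 1) (x\<^sup>2 / 4)) has_real_derivative c * (x / 2)) (at x)"
    using d[of "\<nu> + 1"] assms(1) by (simp add: c_def add_ac)
  have d2: "((\<lambda>x. x / 2 * bessel_phi (\<nu> + 1) (x\<^sup>2 / 4)) has_real_derivative
      1 / 2 * b + (x / 2) * (c * (x / 2))) (at x)"
    by (rule derivative_eq_intros d1 refl | simp add: b_def)+
  have "(bessel_ratio \<nu> has_real_derivative
           ((1 / 2 * b + (x / 2) * (c * (x / 2))) * a - x / 2 * b * (b * (x / 2))) / (a * a)) (at x)"
    unfolding bessel_ratio_def[abs_def]
    using DERIV_divide[OF d2 d0] a by (simp add: a_def b_def)
  \<comment> \<open>The recurrence eliminates the order \<open>\<nu> + 2\<close>, which leaves an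
    expression in the ratio alone.\<close>
  moreover have "?t * c = a - (\<nu> + 1) * b"
    using bessel_phi_recurrence[OF assms(1), of ?t] by (simp add: a_def b_def c_def)
  then have e: "(x / 2) * (c * (x / 2)) = a - (\<nu> + 1) * b" by (simp add: power2_eq_square mult_ac)
  moreover have "((1 / 2 * b + (a - (\<nu> + 1) * b)) * a - x / 2 * b * (b * (x / 2))) / (a * a)
     = 1 - (2 * \<nu> + 1) / x * bessel_ratio \<nu> x - (bessel_ratio \<nu> x)\<^sup>2"
    unfolding bessel_ratio_def a_def[symmetric] b_def[symmetric]
    using a assms by (simp add: field_simps power2_eq_square)
  ultimately show ?thesis unfolding e by (simp only:)
qed

section \<open>The comparison function F as a root of a quadratic\<close>

text \<open>In this form \<open>bessel_F a\<close> is the nonnegative zero of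
  \<open>1 - 2 * a / x * q - q\<^sup>2\<close>, which for \<open>a = \<nu> + 1/2\<close> is the
  right-hand side of the Riccati equation.\<close>

lemma bessel_F_quadratic:
  assumes "a > 0" "x > 0"
  shows "(bessel_F a x)\<^sup>2 + 2 * a / x * bessel_F a x = 1"
proof -
  define R where "R = sqrt (a\<^sup>2 + x\<^sup>2)"
  have R: "R\<^sup>2 = a\<^sup>2 + x\<^sup>2" "R \<ge> 0" by (simp_all add: R_def)
  have p: "a + R > 0" using R assms by simp
  have "(x / (a + R))\<^sup>2 + 2 * a / x * (x / (a + R)) = (x * x + 2 * a * (a + R)) / ((a + R) * (a + R))"
    using p assms by (simp add: divide_simps power2_eq_square)
  also have "x * x + 2 * a * (a + R) = (a + R) * (a + R)"
    using R(1) by (simp add: power2_eq_square algebra_simps)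
  finally show ?thesis
    unfolding bessel_F_def R_def[symmetric] using p by simp
qed

lemma bessel_F_nonneg: "a \<ge> 0 \<Longrightarrow> x \<ge> 0 \<Longrightarrow> bessel_F a x \<ge> 0"
  by (simp add: bessel_F_def)

lemma bessel_F_has_real_derivative:
  assumes "a > 0"
  shows "(bessel_F a has_real_derivative a / (sqrt (a\<^sup>2 + x\<^sup>2) * (a + sqrt (a\<^sup>2 + x\<^sup>2)))) (at x)"
proof -
  define R where "R = sqrt (a\<^sup>2 + x\<^sup>2)"
  have pos: "a\<^sup>2 + x\<^sup>2 > 0" using assms by (simp add: add_pos_nonneg)
  have R: "R\<^sup>2 = a\<^sup>2 + x\<^sup>2" "R > 0" using pos by (simp_all add: R_def)
  have p: "a + R > 0" using R assms by simp
  have "((\<lambda>x. a + sqrt (a\<^sup>2 + x\<^sup>2)) has_real_derivative x / R) (at x)"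
    using pos by (auto intro!: derivative_eq_intros simp: R_def divide_simps)
  then have "(bessel_F a has_real_derivative (1 * (a + R) - x * (x / R)) / ((a + R) * (a + R))) (at x)"
    unfolding bessel_F_def[abs_def] R_def
    by (rule DERIV_divide[OF DERIV_ident]) (use p in \<open>simp add: R_def\<close>)
  moreover have "1 * (a + R) - x * (x / R) = a * (a + R) / R"
    using R by (simp add: field_simps power2_eq_square)
  moreover have "a * (a + R) / R / ((a + R) * (a + R)) = a / (R * (a + R))"
    using p R(2) by (simp add: divide_simps)
  ultimately show ?thesis by (simp add: R_def)
qed

lemma bessel_ratio_continuous_on:
  assumes "\<nu> \<ge> 0"
  shows "continuous_on {0..} (bessel_ratio \<nu>)"
proof -
  have c: "continuous_on {0..} (\<lambda>x. bessel_phi \<nu>' (x\<^sup>2 / 4))" if "\<nu>' \<ge> 0" for \<nu>'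
  proof (rule continuous_on_compose2[of UNIV "bessel_phi \<nu>'"])
    show "continuous_on UNIV (bessel_phi \<nu>')"
      using bessel_phi_has_real_derivative[OF that]
      by (meson DERIV_isCont continuous_at_imp_continuous_on)
  qed (auto intro!: continuous_intros)
  have "bessel_phi \<nu> (x\<^sup>2 / 4) \<noteq> 0" for x using bessel_phi_pos[OF assms, of "x\<^sup>2/4"] by simp
  then show ?thesis
    unfolding bessel_ratio_def[abs_def] using assms
    by (intro continuous_intros c) auto
qed

lemma bessel_F_continuous_on: "a > 0 \<Longrightarrow> continuous_on {0..} (bessel_F a)"
  using bessel_F_has_real_derivative by (meson DERIV_isCont continuous_at_imp_continuous_on)

section \<open>Amos' bounds by comparison\<close>

text \<open>Since F is the zero of the Riccati right-hand side, the ratio has derivative at most 0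
  wherever it exceeds F, while F is nondecreasing in \<open>x\<close>. The comparison principle
  applies to the difference.\<close>

lemma bessel_ratio_le:
  assumes "\<nu> \<ge> 0" "x \<ge> 0"
  shows "bessel_ratio \<nu> x \<le> bessel_F (\<nu> + 1/2) x"
proof -
  have pos: "\<nu> + 1/2 > 0" using assms by simp
  have "bessel_F (\<nu> + 1/2) x - bessel_ratio \<nu> x \<ge> 0"
  proof (rule nonneg_of_deriv_nonneg_when_neg[where w = "\<lambda>t. bessel_F (\<nu> + 1/2) t - bessel_ratio \<nu> t"])
    show "bessel_F (\<nu> + 1/2) 0 - bessel_ratio \<nu> 0 \<ge> 0"
      by (simp add: bessel_F_def bessel_ratio_def)
    show "continuous_on {0..} (\<lambda>t. bessel_F (\<nu> + 1/2) t - bessel_ratio \<nu> t)"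
      by (intro continuous_intros bessel_F_continuous_on bessel_ratio_continuous_on assms pos)
  next
    fix t :: real assume t: "t > 0"
    show "((\<lambda>t. bessel_F (\<nu> + 1/2) t - bessel_ratio \<nu> t) has_real_derivative
       (\<nu> + 1/2) / (sqrt ((\<nu> + 1/2)\<^sup>2 + t\<^sup>2) * (\<nu> + 1/2 + sqrt ((\<nu> + 1/2)\<^sup>2 + t\<^sup>2)))
       - (1 - (2 * \<nu> + 1) / t * bessel_ratio \<nu> t - (bessel_ratio \<nu> t)\<^sup>2)) (at t)"
      by (intro DERIV_diff bessel_F_has_real_derivative bessel_ratio_riccati assms pos t)
    define f where "f = bessel_F (\<nu> + 1/2) t"
    assume "bessel_F (\<nu> + 1/2) t - bessel_ratio \<nu> t < 0"
    then have fr: "0 \<le> f" "f \<le> bessel_ratio \<nu> t"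
      using bessel_F_nonneg[of "\<nu> + 1/2" t] pos t by (simp_all add: f_def)
    have "f\<^sup>2 + (2 * \<nu> + 1) / t * f = 1"
      using bessel_F_quadratic[OF pos t] by (simp add: f_def algebra_simps)
    moreover have "(2 * \<nu> + 1) / t * f \<le> (2 * \<nu> + 1) / t * bessel_ratio \<nu> t"
      using fr assms t by (intro mult_left_mono) auto
    moreover have "f\<^sup>2 \<le> (bessel_ratio \<nu> t)\<^sup>2" using fr by (intro power_mono) auto
    moreover have "(\<nu> + 1/2) / (sqrt ((\<nu> + 1/2)\<^sup>2 + t\<^sup>2) * (\<nu> + 1/2 + sqrt ((\<nu> + 1/2)\<^sup>2 + t\<^sup>2))) \<ge> 0"
      using pos by simp
    ultimately show "(\<nu> + 1/2) / (sqrt ((\<nu> + 1/2)\<^sup>2 + t\<^sup>2) * (\<nu> + 1/2 + sqrt ((\<nu> + 1/2)\<^sup>2 + t\<^sup>2)))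
       - (1 - (2 * \<nu> + 1) / t * bessel_ratio \<nu> t - (bessel_ratio \<nu> t)\<^sup>2) \<ge> 0"
      by linarith
  qed (use assms in auto)
  then show ?thesis by simp
qed

text \<open>At \<open>f = bessel_F (\<nu> + 1) t\<close> the Riccati right-hand side equals
  \<open>f / t\<close>, because \<open>2 * (\<nu> + 1)\<close> exceeds \<open>2 * \<nu> + 1\<close>
  by one. Where the ratio lies below \<open>f\<close>, its derivative is thus at least
  \<open>f / t\<close>, which dominates the derivative of \<open>f\<close>.\<close>

lemma bessel_ratio_ge:
  assumes "\<nu> \<ge> 0" "x \<ge> 0"
  shows "bessel_F (\<nu> + 1) x \<le> bessel_ratio \<nu> x"
proof -
  have pos: "\<nu> + 1 > 0" using assms by simp
  have "bessel_ratio \<nu> x - bessel_F (\<nu> + 1) x \<ge> 0"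
  proof (rule nonneg_of_deriv_nonneg_when_neg[where w = "\<lambda>t. bessel_ratio \<nu> t - bessel_F (\<nu> + 1) t"])
    show "bessel_ratio \<nu> 0 - bessel_F (\<nu> + 1) 0 \<ge> 0"
      by (simp add: bessel_F_def bessel_ratio_def)
    show "continuous_on {0..} (\<lambda>t. bessel_ratio \<nu> t - bessel_F (\<nu> + 1) t)"
      by (intro continuous_intros bessel_F_continuous_on bessel_ratio_continuous_on assms pos)
  next
    fix t :: real assume t: "t > 0"
    define R where "R = sqrt ((\<nu> + 1)\<^sup>2 + t\<^sup>2)"
    show "((\<lambda>t. bessel_ratio \<nu> t - bessel_F (\<nu> + 1) t) has_real_derivative
       (1 - (2 * \<nu> + 1) / t * bessel_ratio \<nu> t - (bessel_ratio \<nu> t)\<^sup>2)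
       - (\<nu> + 1) / (R * (\<nu> + 1 + R))) (at t)"
      unfolding R_def
      by (intro DERIV_diff bessel_F_has_real_derivative bessel_ratio_riccati assms pos t)
    define f where "f = bessel_F (\<nu> + 1) t"
    assume "bessel_ratio \<nu> t - bessel_F (\<nu> + 1) t < 0"
    then have fr: "0 \<le> bessel_ratio \<nu> t" "bessel_ratio \<nu> t \<le> f"
      using bessel_ratio_nonneg[of \<nu> t] assms t by (simp_all add: f_def)
    have "f\<^sup>2 + 2 * (\<nu> + 1) / t * f = 1"
      using bessel_F_quadratic[OF pos t] by (simp add: f_def)
    then have "f\<^sup>2 + (2 * \<nu> + 1) / t * f + f / t = 1"
      using t by (simp add: field_simps)
    moreover have "(2 * \<nu> + 1) / t * bessel_ratio \<nu> t \<le> (2 * \<nu> + 1) / t * f"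
      using fr assms t by (intro mult_left_mono) auto
    moreover have "(bessel_ratio \<nu> t)\<^sup>2 \<le> f\<^sup>2" using fr by (intro power_mono) auto
    moreover have "(\<nu> + 1) / (R * (\<nu> + 1 + R)) \<le> f / t"
    proof -
      have "\<nu> + 1 \<le> R" unfolding R_def by (rule real_le_rsqrt) simp
      then show ?thesis
        unfolding f_def bessel_F_def R_def[symmetric] using pos t by (simp add: divide_simps)
    qed
    ultimately show "(1 - (2 * \<nu> + 1) / t * bessel_ratio \<nu> t - (bessel_ratio \<nu> t)\<^sup>2)
       - (\<nu> + 1) / (R * (\<nu> + 1 + R)) \<ge> 0"
      by linarith
  qed (use assms in auto)
  then show ?thesis by simp
qed

subsection \<open>The series \<open>H\<close>\<close>

lemma bessel_F_antimono:
  assumes "0 \<le> a" "a \<le> b" "x \<ge> 0"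
  shows "bessel_F b x \<le> bessel_F a x"
proof (cases "x = 0")
  case False
  then have x: "x > 0" using assms by simp
  have "a + sqrt (a\<^sup>2 + x\<^sup>2) \<le> b + sqrt (b\<^sup>2 + x\<^sup>2)"
    using assms by (intro add_mono real_sqrt_le_mono power_mono) auto
  moreover have "a + sqrt (a\<^sup>2 + x\<^sup>2) > 0" using assms x by (simp add: add_nonneg_pos sum_power2_gt_zero_iff)
  ultimately show ?thesis unfolding bessel_F_def using x by (intro divide_left_mono mult_pos_pos) auto
qed (simp add: bessel_F_def)

lemma bessel_F_less_1:
  assumes "a > 0" "x \<ge> 0"
  shows "bessel_F a x < 1"
proof -
  have "x \<le> sqrt (a\<^sup>2 + x\<^sup>2)" by (rule real_le_rsqrt) simp
  then have "x < a + sqrt (a\<^sup>2 + x\<^sup>2)" using assms by linarith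
  then show ?thesis using assms by (simp add: bessel_F_def divide_less_eq_1)
qed

lemma bessel_F_eq_exp:
  assumes "x > 0"
  shows "bessel_F a x = exp (- arsinh (a / x))"
proof -
  have "sqrt ((a / x)\<^sup>2 + 1) = sqrt (a\<^sup>2 + x\<^sup>2) / x"
    using assms by (simp add: real_sqrt_divide[symmetric] power_divide field_simps real_sqrt_divide)
  then have "a / x + sqrt ((a / x)\<^sup>2 + 1) = (a + sqrt (a\<^sup>2 + x\<^sup>2)) / x"
    by (simp add: add_divide_distrib)
  moreover have "a / x + sqrt ((a / x)\<^sup>2 + 1) > 0" by (rule arsinh_real_aux)
  ultimately show ?thesis
    by (simp add: arsinh_real_def exp_minus bessel_F_def)
qed

lemma sinh_convex: "convex_on {0..} (sinh :: real \<Rightarrow> real)"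
  by (rule f''_ge0_imp_convex[where f' = cosh and f'' = sinh])
     (auto intro!: derivative_eq_intros)

lemma arsinh_le_self:
  assumes "t \<ge> 0"
  shows "arsinh t \<le> (t :: real)"
proof -
  have "sinh 0 - 0 \<le> sinh t - t"
  proof (rule DERIV_nonneg_imp_nondecreasing[of 0 t "\<lambda>t. sinh t - t"])
    fix u :: real
    have "((\<lambda>t. sinh t - t) has_real_derivative cosh u - 1) (at u)"
      by (auto intro!: derivative_eq_intros)
    then show "\<exists>y. ((\<lambda>t. sinh t - t) has_real_derivative y) (at u) \<and> y \<ge> 0"
      using cosh_real_ge_1[of u] by (intro exI[of _ "cosh u - 1"]) simp
  qed fact
  then have "sinh (arsinh t) \<le> sinh t" by simp
  then show ?thesis by (simp only: sinh_real_le_iff)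
qed

lemma alpha0_eq: "alpha0 = arsinh 1"
proof -
  have "(sqrt 2 - 1) * (sqrt 2 + 1) = (1::real)" by (simp add: algebra_simps)
  then have "inverse (sqrt 2 - 1) = 1 + sqrt (2::real)"
    by (simp add: inverse_eq_divide divide_simps algebra_simps)
  then show ?thesis
    by (simp add: alpha0_def arsinh_real_def ln_inverse[symmetric])
qed

lemma alpha0_pos: "alpha0 > 0"
  by (simp add: alpha0_eq)

text \<open>Convexity puts \<open>sinh\<close> below its chord from 0 to \<open>alpha0\<close>, and
  \<open>sinh alpha0 = 1\<close>; applying \<open>arsinh\<close> gives the bound.\<close>

lemma alpha0_le_arsinh:
  assumes "0 \<le> t" "t \<le> 1"
  shows "alpha0 * t \<le> arsinh t"
proof -
  have "sinh ((1 - t) * 0 + t * alpha0) \<le> (1 - t) * sinh 0 + t * sinh alpha0"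
    using assms alpha0_pos convex_onD[OF sinh_convex, of t 0 alpha0] by simp
  also have "\<dots> = sinh (arsinh t)" by (simp add: alpha0_eq)
  finally have "(1 - t) * 0 + t * alpha0 \<le> arsinh t" by (simp only: sinh_real_le_iff)
  then show ?thesis by (simp add: mult.commute)
qed

lemma bessel_F_ge_exp:
  assumes "a \<ge> 0" "x > 0"
  shows "exp (- a / x) \<le> bessel_F a x"
  using assms arsinh_le_self[of "a / x"] by (simp add: bessel_F_eq_exp)

lemma bessel_F_le_exp:
  assumes "0 \<le> a" "a \<le> x" "x > 0"
  shows "bessel_F a x \<le> exp (- alpha0 * a / x)"
  using assms alpha0_le_arsinh[of "a / x"] by (simp add: bessel_F_eq_exp)

section \<open>The terms of H as products of ratios\<close>

text \<open>The product of the first \<open>k\<close> ratios. The series of \<open>bessel_H\<close>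
  starts at index 1, hence the \<open>Suc k\<close> in the sums below.\<close>

definition bessel_P :: "real \<Rightarrow> real \<Rightarrow> nat \<Rightarrow> real" where
  "bessel_P \<nu> x k = bessel_I (\<nu> + real k) x / bessel_I \<nu> x"

context
  fixes \<nu> x :: real
  assumes nu: "\<nu> \<ge> 0" and x: "x > 0"
begin

lemma bessel_P_0 [simp]: "bessel_P \<nu> x 0 = 1"
  using bessel_I_pos[OF nu x] by (simp add: bessel_P_def)

lemma bessel_P_Suc: "bessel_P \<nu> x (Suc k) = bessel_P \<nu> x k * bessel_ratio (\<nu> + real k) x"
  using bessel_I_Suc[of "\<nu> + real k" x] nu x by (simp add: bessel_P_def add_ac)

lemma bessel_P_pos: "bessel_P \<nu> x k > 0"
  using nu x by (simp add: bessel_P_def bessel_I_pos)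

text \<open>The exponent is the sum of \<open>(\<nu> + i) / x\<close> over
  \<open>i = 1, ..., k\<close>, one term for each ratio.\<close>

lemma bessel_P_ge: "exp (- (real k * (2 * \<nu> + real k + 1)) / (2 * x)) \<le> bessel_P \<nu> x k"
proof (induction k)
  case (Suc k)
  have "exp (- (real (Suc k) * (2 * \<nu> + real (Suc k) + 1)) / (2 * x))
     = exp (- (real k * (2 * \<nu> + real k + 1)) / (2 * x)) * exp (- (\<nu> + real k + 1) / x)"
    using x by (simp add: exp_add[symmetric] field_simps)
  also have "\<dots> \<le> bessel_P \<nu> x k * bessel_F (\<nu> + real k + 1) x"
    using nu x bessel_P_pos[of k] by (intro mult_mono Suc bessel_F_ge_exp) auto
  also have "\<dots> \<le> bessel_P \<nu> x (Suc k)"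
    unfolding bessel_P_Suc using nu x bessel_P_pos[of k]
    by (intro mult_left_mono bessel_ratio_ge) auto
  finally show ?case .
qed simp

text \<open>The exponent collects \<open>\<nu> + i + 1/2\<close> over \<open>i < k\<close>. The
  largest of these is \<open>\<nu> + k - 1/2\<close>, so the hypothesis keeps all of them in the
  range \<open>a \<le> x\<close> of \<open>bessel_F_le_exp\<close>.\<close>

lemma bessel_P_le:
  assumes "\<nu> + real k \<le> x + 1/2"
  shows "bessel_P \<nu> x k \<le> exp (- (alpha0 / (2 * x)) * (real k * (2 * \<nu> + real k)))"
  using assms
proof (induction k)
  case (Suc k)
  have "bessel_P \<nu> x (Suc k) \<le> bessel_P \<nu> x k * bessel_F (\<nu> + real k + 1/2) x"
    unfolding bessel_P_Suc using nu x bessel_P_pos[of k]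
    by (intro mult_left_mono bessel_ratio_le) auto
  also have "\<dots> \<le> exp (- (alpha0 / (2 * x)) * (real k * (2 * \<nu> + real k)))
       * exp (- alpha0 * (\<nu> + real k + 1/2) / x)"
    using nu x Suc by (intro mult_mono Suc bessel_F_le_exp bessel_F_nonneg) auto
  also have "\<dots> = exp (- (alpha0 / (2 * x)) * (real (Suc k) * (2 * \<nu> + real (Suc k))))"
    using x by (simp add: exp_add[symmetric] field_simps)
  finally show ?case .
qed simp

text \<open>The first ratio keeps its own bound; F decreases in the order, so every later ratio is
  at most \<open>bessel_F (\<nu> + 3/2) x\<close>.\<close>

lemma bessel_P_le_geometric:
  "bessel_P \<nu> x (Suc k) \<le> bessel_F (\<nu> + 1/2) x * bessel_F (\<nu> + 3/2) x ^ k"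
proof (induction k)
  case 0
  then show ?case using bessel_P_Suc[of 0] bessel_ratio_le[of \<nu> x] nu x by simp
next
  case (Suc k)
  have "bessel_ratio (\<nu> + real (Suc k)) x \<le> bessel_F (\<nu> + real (Suc k) + 1/2) x"
    using nu x by (intro bessel_ratio_le) auto
  also have "\<dots> \<le> bessel_F (\<nu> + 3/2) x"
    using nu x by (intro bessel_F_antimono) auto
  finally have "bessel_P \<nu> x (Suc k) * bessel_ratio (\<nu> + real (Suc k)) x
     \<le> (bessel_F (\<nu> + 1/2) x * bessel_F (\<nu> + 3/2) x ^ k) * bessel_F (\<nu> + 3/2) x"
    using nu x bessel_P_pos[of "Suc k"]
    by (intro mult_mono Suc bessel_ratio_nonneg mult_nonneg_nonneg zero_le_power bessel_F_nonneg) auto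
  then show ?case using bessel_P_Suc[of "Suc k"] by (simp add: mult_ac)
qed

lemma bessel_P_geometric_sums:
  "(\<lambda>k. bessel_F (\<nu> + 1/2) x * bessel_F (\<nu> + 3/2) x ^ k) sums
     (bessel_F (\<nu> + 1/2) x / (1 - bessel_F (\<nu> + 3/2) x))"
proof -
  have "norm (bessel_F (\<nu> + 3/2) x) < 1"
    using bessel_F_less_1[of "\<nu> + 3/2" x] bessel_F_nonneg[of "\<nu> + 3/2" x] nu x by simp
  from sums_mult[OF geometric_sums[OF this], of "bessel_F (\<nu> + 1/2) x"] show ?thesis by simp
qed

lemma bessel_P_summable: "summable (\<lambda>k. bessel_P \<nu> x (Suc k))"
proof (rule summable_comparison_test')
  show "summable (\<lambda>k. bessel_F (\<nu> + 1/2) x * bessel_F (\<nu> + 3/2) x ^ k)"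
    using bessel_P_geometric_sums by (rule sums_summable)
  show "norm (bessel_P \<nu> x (Suc k)) \<le> bessel_F (\<nu> + 1/2) x * bessel_F (\<nu> + 3/2) x ^ k" for k
    using bessel_P_le_geometric[of k] bessel_P_pos[of "Suc k"] by simp
qed

lemma bessel_H_eq: "bessel_H \<nu> x = (\<Sum>k. bessel_P \<nu> x (Suc k))"
  by (simp add: bessel_H_def bessel_P_def)

lemma bessel_H_nonneg: "bessel_H \<nu> x \<ge> 0"
  unfolding bessel_H_eq using bessel_P_pos by (intro suminf_nonneg bessel_P_summable) (simp add: less_imp_le)

lemma bessel_H_le: "bessel_H \<nu> x \<le> bessel_F (\<nu> + 1/2) x / (1 - bessel_F (\<nu> + 3/2) x)"
proof -
  have "bessel_H \<nu> x \<le> (\<Sum>k. bessel_F (\<nu> + 1/2) x * bessel_F (\<nu> + 3/2) x ^ k)"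
    unfolding bessel_H_eq
    by (intro suminf_le bessel_P_le_geometric bessel_P_summable sums_summable[OF bessel_P_geometric_sums])
  then show ?thesis using bessel_P_geometric_sums by (simp add: sums_iff)
qed

end

lemma bessel_H_split:
  assumes nu: "\<nu> \<ge> 0" and x: "x > 0"
  shows "bessel_H \<nu> x = (\<Sum>k<n. bessel_P \<nu> x (Suc k)) + bessel_P \<nu> x n * bessel_H (\<nu> + real n) x"
proof -
  have "bessel_P \<nu> x (Suc (k + n)) = bessel_P \<nu> x n * bessel_P (\<nu> + real n) x (Suc k)" for k
    using bessel_I_pos[of "\<nu> + real n" x] nu x by (simp add: bessel_P_def add_ac)
  then have "(\<Sum>k. bessel_P \<nu> x (Suc (k + n))) = bessel_P \<nu> x n * bessel_H (\<nu> + real n) x"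
    using nu x by (simp add: bessel_H_eq suminf_mult bessel_P_summable)
  then show ?thesis
    using suminf_split_initial_segment[OF bessel_P_summable[OF nu x], of n]
    by (simp add: bessel_H_eq[OF nu x])
qed

lemma bessel_H_ge_step:
  assumes "\<nu> \<ge> 0" "x > 0"
  shows "bessel_F (\<nu> + 1) x * (1 + bessel_H (\<nu> + 1) x) \<le> bessel_H \<nu> x"
proof -
  have "bessel_H \<nu> x = bessel_ratio \<nu> x * (1 + bessel_H (\<nu> + 1) x)"
    using bessel_H_split[OF assms, of 1] bessel_P_Suc[OF assms, of 0] assms
    by (simp add: bessel_P_0[OF assms] algebra_simps)
  then show ?thesis
    using bessel_ratio_ge[of \<nu> x] bessel_H_nonneg[of "\<nu> + 1" x] assms
    by (simp add: mult_right_mono)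
qed

text \<open>Three unfoldings of \<open>bessel_H_ge_step\<close>, with the innermost H replaced by 0.
  The third level is what later pays for the endpoint deficit in \<open>lower_L\<close>.\<close>

lemma bessel_H_ge:
  assumes "\<nu> \<ge> 0" "x > 0"
  shows "bessel_F (\<nu> + 1) x * (1 + bessel_F (\<nu> + 2) x * (1 + bessel_F (\<nu> + 3) x)) \<le> bessel_H \<nu> x"
proof -
  have n: "bessel_F (\<nu> + 1) x \<ge> 0" "bessel_F (\<nu> + 2) x \<ge> 0" "bessel_F (\<nu> + 3) x \<ge> 0"
    using assms by (auto intro!: bessel_F_nonneg)
  have "bessel_F (\<nu> + 3) x * (1 + 0) \<le> bessel_F (\<nu> + 3) x * (1 + bessel_H (\<nu> + 3) x)"
    using assms n bessel_H_nonneg[of "\<nu> + 3" x] by (intro mult_left_mono) auto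
  also have "\<dots> \<le> bessel_H (\<nu> + 2) x"
    using bessel_H_ge_step[of "\<nu> + 2" x] assms by (simp add: add_ac)
  finally have "bessel_F (\<nu> + 2) x * (1 + bessel_F (\<nu> + 3) x) \<le> bessel_F (\<nu> + 2) x * (1 + bessel_H (\<nu> + 2) x)"
    using n by (intro mult_left_mono) auto
  also have "\<dots> \<le> bessel_H (\<nu> + 1) x"
    using bessel_H_ge_step[of "\<nu> + 1" x] assms by (simp add: add_ac)
  finally have "bessel_F (\<nu> + 1) x * (1 + bessel_F (\<nu> + 2) x * (1 + bessel_F (\<nu> + 3) x))
      \<le> bessel_F (\<nu> + 1) x * (1 + bessel_H (\<nu> + 1) x)"
    using n by (intro mult_left_mono) auto
  also have "\<dots> \<le> bessel_H \<nu> x" by (rule bessel_H_ge_step[OF assms])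
  finally show ?thesis .
qed

subsection \<open>Gaussian integrals and Mills ratio bounds\<close>

text \<open>For \<open>s \<ge> 0\<close> this is the error function without its normalising factor
  \<open>2 / sqrt pi\<close>.\<close>

definition gauss_int :: "real \<Rightarrow> real" where
  "gauss_int s = integral {0..s} (\<lambda>t. exp (- t\<^sup>2))"

lemma gauss_int_has_real_derivative:
  assumes "s > 0"
  shows "(gauss_int has_real_derivative exp (- s\<^sup>2)) (at s)"
proof -
  have "((\<lambda>u. integral {0..u} (\<lambda>t. exp (- t\<^sup>2))) has_real_derivative exp (- s\<^sup>2)) (at s within {0..s + 1})"
    using assms by (intro integral_has_real_derivative continuous_intros) auto
  then have "(gauss_int has_real_derivative exp (- s\<^sup>2)) (at s within {0<..<s + 1})"
    unfolding gauss_int_def[abs_def] by (rule DERIV_subset) auto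
  then show ?thesis using assms at_within_open[of s "{0<..<s + 1}"] by auto
qed

lemma gauss_int_continuous_on: "continuous_on {0..} gauss_int"
proof -
  have "continuous_on {0..T} gauss_int" for T
    unfolding gauss_int_def[abs_def]
    by (intro indefinite_integral_continuous_1 integrable_continuous_real continuous_intros)
  note cont = this
  have "continuous (at s within {0..}) gauss_int" if "s \<ge> 0" for s
  proof -
    have "continuous (at s within {0..s + 1}) gauss_int"
      using cont[of "s + 1"] that by (simp add: continuous_on_eq_continuous_within)
    moreover have "at s within {0..s + 1} = at s within {0..}"
      by (rule at_within_nhd[of _ "{..<s + 1}"]) auto
    ultimately show ?thesis by simp
  qed
  then show ?thesis by (simp add: continuous_on_eq_continuous_within)
qed

text \<open>The zeroth Gaussian moment gives the Lebesgue integral over the half-line; the truncated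
  integrals converge to it and agree with the gauge integral in \<open>gauss_int\<close>.\<close>

lemma gauss_int_tendsto: "(gauss_int \<longlongrightarrow> sqrt pi / 2) at_top"
proof -
  let ?f = "\<lambda>x::real. indicator {0..} x *\<^sub>R exp (- x\<^sup>2)"
  have "((\<lambda>y. \<integral>x. indicator {..y} x *\<^sub>R ?f x \<partial>lborel) \<longlongrightarrow> (\<integral>x. ?f x \<partial>lborel)) at_top"
    using gaussian_moment_0 by (intro tendsto_integral_at_top) (auto simp: has_bochner_integral_iff)
  moreover have "(\<integral>x. ?f x \<partial>lborel) = sqrt pi / 2"
    using gaussian_moment_0 by (simp add: has_bochner_integral_iff)
  moreover have "(\<integral>x. indicator {..y} x *\<^sub>R ?f x \<partial>lborel) = gauss_int y" for y
  proof -
    have "(\<integral>x. indicator {..y} x *\<^sub>R ?f x \<partial>lborel) = (LINT x:{0..y}|lborel. exp (- x\<^sup>2))"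
      unfolding set_lebesgue_integral_def
      by (intro Bochner_Integration.integral_cong) (auto simp: indicator_def)
    also have "\<dots> = gauss_int y"
      unfolding gauss_int_def
      by (intro set_borel_integral_eq_integral borel_integrable_atLeastAtMost' continuous_intros)
    finally show ?thesis .
  qed
  ultimately show ?thesis by (simp only:)
qed

text \<open>By substitution, the integral of \<open>exp (- c * t\<^sup>2)\<close> over
  \<open>[0, s]\<close>.\<close>

definition scaled_gauss_int :: "real \<Rightarrow> real \<Rightarrow> real" where
  "scaled_gauss_int c s = gauss_int (sqrt c * s) / sqrt c"

lemma scaled_gauss_int_has_real_derivative:
  assumes "c > 0" "s > 0"
  shows "(scaled_gauss_int c has_real_derivative exp (- c * s\<^sup>2)) (at s)"
proof -
  have "((\<lambda>s. gauss_int (sqrt c * s)) has_real_derivative exp (- (sqrt c * s)\<^sup>2) * sqrt c) (at s)"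
    using assms by (intro DERIV_chain2[OF gauss_int_has_real_derivative] DERIV_cmult_Id) simp
  then have "(scaled_gauss_int c has_real_derivative exp (- (sqrt c * s)\<^sup>2) * sqrt c / sqrt c) (at s)"
    unfolding scaled_gauss_int_def[abs_def] by (rule DERIV_cdivide)
  then show ?thesis using assms by (simp add: power_mult_distrib)
qed

lemma scaled_gauss_int_continuous_on:
  assumes "c > 0"
  shows "continuous_on {0..} (scaled_gauss_int c)"
  unfolding scaled_gauss_int_def[abs_def] using assms
  by (intro continuous_intros continuous_on_compose2[OF gauss_int_continuous_on]) auto

lemma scaled_gauss_int_tendsto:
  assumes "c > 0"
  shows "(scaled_gauss_int c \<longlongrightarrow> sqrt pi / 2 / sqrt c) at_top"
proof -
  have "filterlim (\<lambda>s. sqrt c * s) at_top at_top"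
    using assms by (intro filterlim_tendsto_pos_mult_at_top[OF tendsto_const]) (auto simp: filterlim_ident)
  then have "((\<lambda>s. gauss_int (sqrt c * s)) \<longlongrightarrow> sqrt pi / 2) at_top"
    by (rule filterlim_compose[OF gauss_int_tendsto])
  then show ?thesis unfolding scaled_gauss_int_def[abs_def] using assms
    by (intro tendsto_divide tendsto_const) auto
qed

text \<open>
  For \<open>a = 2\<close> and \<open>a = 4/\<pi>\<close> these are the classical lower and upper approximations to the integral
  of \<open>exp (- c t\<^sup>2)\<close> over \<open>[s, \<infinity>)\<close>.
\<close>

definition mills :: "real \<Rightarrow> real \<Rightarrow> real \<Rightarrow> real" where
  "mills a c s = exp (- c * s\<^sup>2) / (c * (s + sqrt (s\<^sup>2 + a / c)))"

text \<open>The summand \<open>- 1\<close> is split off so that it cancels against the derivative of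
  \<open>scaled_gauss_int\<close>; what remains has the sign of
  \<open>c * s\<^sup>2 + a - 1 - c * s * r\<close> for \<open>s > 0\<close>.\<close>

lemma mills_has_real_derivative:
  fixes a c s :: real
  assumes "a > 0" "c > 0" "s \<ge> 0"
  defines "r \<equiv> sqrt (s\<^sup>2 + a / c)"
  shows "(mills a c has_real_derivative
     exp (- c * s\<^sup>2) * ((c * s\<^sup>2 + a - 1 - c * s * r) / (c * r * (s + r)) - 1)) (at s)"
proof -
  have pos: "s\<^sup>2 + a / c > 0" using assms by (simp add: add_nonneg_pos)
  have r: "r > 0" "r\<^sup>2 = s\<^sup>2 + a / c" using pos by (simp_all add: r_def)
  have cr: "c * (r * r) = c * (s * s) + a" using r(2) assms by (simp add: field_simps power2_eq_square)
  have sr: "s + r > 0" using r(1) assms(3) by (rule add_nonneg_pos[rotated])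
  define E where "E = exp (- c * s\<^sup>2)"
  have dE: "((\<lambda>s. exp (- c * s\<^sup>2)) has_real_derivative E * (- 2 * c * s)) (at s)"
    by (auto intro!: derivative_eq_intros simp: E_def)
  have dd: "((\<lambda>s. c * (s + sqrt (s\<^sup>2 + a / c))) has_real_derivative c * (1 + s / r)) (at s)"
  proof (intro DERIV_cmult DERIV_add DERIV_ident)
    show "((\<lambda>s. sqrt (s\<^sup>2 + a / c)) has_real_derivative s / r) (at s)"
    proof -
      have "((\<lambda>s. s\<^sup>2 + a / c) has_real_derivative 2 * s) (at s)"
        by (auto intro!: derivative_eq_intros)
      from DERIV_chain2[OF DERIV_real_sqrt[OF pos] this] show ?thesis
        by (simp add: r_def inverse_eq_divide)
    qed
  qed
  have "(mills a c has_real_derivative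
     (E * (- 2 * c * s) * (c * (s + r)) - E * (c * (1 + s / r))) / ((c * (s + r)) * (c * (s + r)))) (at s)"
    unfolding mills_def[abs_def] E_def r_def
    by (rule DERIV_divide[OF dE[unfolded E_def] dd[unfolded r_def]])
       (use sr[unfolded r_def] \<open>c > 0\<close> in simp)
  also have "(E * (- 2 * c * s) * (c * (s + r)) - E * (c * (1 + s / r))) / ((c * (s + r)) * (c * (s + r)))
      = E * (- (2 * c * s * r + 1) / (c * r * (s + r)))"
  proof -
    have "c * (1 + s / r) = c * (s + r) / r" using r by (simp add: field_simps)
    then have "E * (- 2 * c * s) * (c * (s + r)) - E * (c * (1 + s / r))
      = (c * (s + r)) * (E * (- (2 * c * s * r + 1) / r))"
      using r by (simp add: field_simps)
    then show ?thesis using sr assms r by simp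
  qed
  also have "- (2 * c * s * r + 1) / (c * r * (s + r))
     = (c * s\<^sup>2 + a - 1 - c * s * r) / (c * r * (s + r)) - 1"
  proof -
    have "c * s\<^sup>2 + a - 1 - c * s * r = c * r * (s + r) - (2 * c * s * r + 1)"
      using cr by (simp add: algebra_simps power2_eq_square)
    moreover have "c * r * (s + r) \<noteq> 0" using sr r(1) assms(2) by simp
    moreover have "- N / D = (D - N) / D - 1" if "D \<noteq> 0" for N D :: real
      using that by (simp add: diff_divide_distrib)
    ultimately show ?thesis by (simp only:)
  qed
  finally show ?thesis by (simp add: E_def)
qed

lemma mills_continuous_on:
  assumes "a > 0" "c > 0"
  shows "continuous_on {0..} (mills a c)"
  using mills_has_real_derivative[OF assms]
  by (intro continuous_at_imp_continuous_on ballI DERIV_isCont) auto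

lemma mills_tendsto:
  assumes "a > 0" "c > 0"
  shows "(mills a c \<longlongrightarrow> 0) at_top"
proof (rule tendsto_sandwich[of "\<lambda>_. 0" "mills a c" _ "\<lambda>s. 1 / (c * s)"])
  have "filterlim (\<lambda>s. c * s) at_top at_top"
    using assms by (intro filterlim_tendsto_pos_mult_at_top[OF tendsto_const]) (auto simp: filterlim_ident)
  then show "((\<lambda>s. 1 / (c * s)) \<longlongrightarrow> 0) at_top"
    by (intro tendsto_divide_0[OF tendsto_const] filterlim_at_top_imp_at_infinity)
  show "\<forall>\<^sub>F s in at_top. mills a c s \<le> 1 / (c * s)"
    using eventually_gt_at_top[of 0]
  proof eventually_elim
    case (elim s)
    have "exp (- c * s\<^sup>2) \<le> 1" using assms by simp
    moreover have "c * s \<le> c * (s + sqrt (s\<^sup>2 + a / c))" using assms by simp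
    ultimately show ?case unfolding mills_def using elim assms by (intro frac_le) auto
  qed
  show "\<forall>\<^sub>F s in at_top. 0 \<le> mills a c s"
    using eventually_gt_at_top[of 0]
    by eventually_elim (use assms in \<open>simp add: mills_def\<close>)
qed auto

section \<open>Inequalities between Mills approximations and Gaussian integrals\<close>

text \<open>For \<open>a = 2\<close> the numerator is \<open>c * s\<^sup>2 + 1 - c * s * r\<close>.
  It is nonnegative since the squares of \<open>c * s\<^sup>2 + 1\<close> and
  \<open>c * s * r\<close> differ by exactly 1.\<close>

lemma mills_2_deriv_ge:
  assumes "c > 0" "s \<ge> 0"
  obtains y where "(mills 2 c has_real_derivative y) (at s)" "y \<ge> - exp (- c * s\<^sup>2)"
proof (rule that)
  let ?r = "sqrt (s\<^sup>2 + 2 / c)"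
  show "(mills 2 c has_real_derivative
     exp (- c * s\<^sup>2) * ((c * s\<^sup>2 + 2 - 1 - c * s * ?r) / (c * ?r * (s + ?r)) - 1)) (at s)"
    using assms by (intro mills_has_real_derivative) auto
  have "c * s * ?r \<le> c * s\<^sup>2 + 1"
  proof (rule power2_le_imp_le)
    have "(c * s * ?r)\<^sup>2 = c\<^sup>2 * s\<^sup>2 * (s\<^sup>2 + 2 / c)" using assms by (simp add: power_mult_distrib)
    also have "\<dots> \<le> (c * s\<^sup>2 + 1)\<^sup>2" using assms by (simp add: power2_eq_square algebra_simps)
    finally show "(c * s * ?r)\<^sup>2 \<le> (c * s\<^sup>2 + 1)\<^sup>2" .
  qed (use assms in simp)
  then have "0 \<le> exp (- c * s\<^sup>2) * ((c * s\<^sup>2 + 2 - 1 - c * s * ?r) / (c * ?r * (s + ?r)))"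
    using assms by (intro mult_nonneg_nonneg divide_nonneg_nonneg) auto
  then show "exp (- c * s\<^sup>2) * ((c * s\<^sup>2 + 2 - 1 - c * s * ?r) / (c * ?r * (s + ?r)) - 1) \<ge> - exp (- c * s\<^sup>2)"
    by (simp add: algebra_simps)
qed

text \<open>The approximation falls no faster than the Gaussian, which on the unit interval is at
  most its value at the left end.\<close>

lemma mills_2_diff_le:
  assumes "c > 0" "s \<ge> 0"
  shows "mills 2 c s - mills 2 c (s + 1) \<le> exp (- c * s\<^sup>2)"
proof -
  let ?h = "\<lambda>t. mills 2 c t + t * exp (- c * s\<^sup>2)"
  have "?h s \<le> ?h (s + 1)"
  proof (rule DERIV_nonneg_imp_increasing_open[of s "s + 1" ?h])
    fix t assume t: "s < t" "t < s + 1"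
    obtain y where y: "(mills 2 c has_real_derivative y) (at t)" "y \<ge> - exp (- c * t\<^sup>2)"
      using mills_2_deriv_ge[of c t] assms t by auto
    have "s\<^sup>2 \<le> t\<^sup>2" using t assms by (intro power_mono) auto
    then have "exp (- c * t\<^sup>2) \<le> exp (- c * s\<^sup>2)" using assms by simp
    then have "y + 1 * exp (- c * s\<^sup>2) \<ge> 0" using y(2) by linarith
    moreover have "(?h has_real_derivative y + 1 * exp (- c * s\<^sup>2)) (at t)"
      by (intro DERIV_add y DERIV_cmult_right DERIV_ident)
    ultimately show "\<exists>y. (?h has_real_derivative y) (at t) \<and> y \<ge> 0" by blast
  next
    show "continuous_on {s..s + 1} ?h"
      using assms
      by (intro continuous_intros continuous_on_subset[OF mills_continuous_on]) auto
  qed simp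
  then show ?thesis by (simp add: algebra_simps)
qed

lemma scaled_gauss_int_diff_ge:
  assumes "c > 0" "s \<ge> 0"
  shows "exp (- c * (s + 1)\<^sup>2) \<le> scaled_gauss_int c (s + 1) - scaled_gauss_int c s"
proof -
  let ?h = "\<lambda>t. scaled_gauss_int c t - t * exp (- c * (s + 1)\<^sup>2)"
  have "?h s \<le> ?h (s + 1)"
  proof (rule DERIV_nonneg_imp_increasing_open[of s "s + 1" ?h])
    fix t assume t: "s < t" "t < s + 1"
    have "t\<^sup>2 \<le> (s + 1)\<^sup>2" using t assms by (intro power_mono) auto
    then have "exp (- c * (s + 1)\<^sup>2) \<le> exp (- c * t\<^sup>2)" using assms by simp
    moreover have "(?h has_real_derivative exp (- c * t\<^sup>2) - 1 * exp (- c * (s + 1)\<^sup>2)) (at t)"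
      using assms t
      by (intro DERIV_diff scaled_gauss_int_has_real_derivative DERIV_cmult_right DERIV_ident) auto
    ultimately show "\<exists>y. (?h has_real_derivative y) (at t) \<and> y \<ge> 0"
      by (intro exI[of _ "exp (- c * t\<^sup>2) - 1 * exp (- c * (s + 1)\<^sup>2)"]) auto
  next
    show "continuous_on {s..s + 1} ?h"
      using assms
      by (intro continuous_intros continuous_on_subset[OF scaled_gauss_int_continuous_on]) auto
  qed simp
  then show ?thesis by (simp add: algebra_simps)
qed

text \<open>The left-hand side is nondecreasing in \<open>s\<close> and tends to the full Gaussian
  integral.\<close>

lemma mills_2_lower:
  assumes "c > 0" "s \<ge> 0"
  shows "mills 2 c s + scaled_gauss_int c s \<le> sqrt pi / 2 / sqrt c"
proof -
  let ?h = "\<lambda>t. mills 2 c t + scaled_gauss_int c t"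
  have "(?h \<longlongrightarrow> 0 + sqrt pi / 2 / sqrt c) at_top"
    using assms by (intro tendsto_add mills_tendsto scaled_gauss_int_tendsto) auto
  moreover have "\<forall>\<^sub>F T in at_top. ?h s \<le> ?h T"
    using eventually_ge_at_top[of s]
  proof eventually_elim
    case (elim T)
    show ?case
    proof (rule DERIV_nonneg_imp_increasing_open[of s T ?h])
      fix t assume t: "s < t" "t < T"
      obtain y where y: "(mills 2 c has_real_derivative y) (at t)" "y \<ge> - exp (- c * t\<^sup>2)"
        using mills_2_deriv_ge[of c t] assms t by auto
      have "(?h has_real_derivative y + exp (- c * t\<^sup>2)) (at t)"
        using assms t by (intro DERIV_add y scaled_gauss_int_has_real_derivative) auto
      then show "\<exists>y. (?h has_real_derivative y) (at t) \<and> y \<ge> 0"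
        using y(2) by (intro exI[of _ "y + exp (- c * t\<^sup>2)"]) auto
    next
      show "continuous_on {s..T} ?h"
        using assms
        by (intro continuous_intros continuous_on_subset[OF mills_continuous_on]
              continuous_on_subset[OF scaled_gauss_int_continuous_on]) auto
    qed (use elim in simp)
  qed
  ultimately show ?thesis using tendsto_lowerbound[of ?h _ at_top "?h s"] by simp
qed

text \<open>The constant \<open>4 / pi\<close> is the one for which equality holds at
  \<open>s = 0\<close>.\<close>

lemma mills_4_over_pi_upper:
  assumes "c > 0" "s \<ge> 0"
  shows "sqrt pi / 2 / sqrt c \<le> mills (4 / pi) c s + scaled_gauss_int c s"
proof -
  define a where "a = 4 / pi"
  have a: "1 < a" "a < 2"
    using pi_gt3 pi_less_4 by (simp_all add: a_def divide_simps)
  define L where "L = sqrt pi / 2 / sqrt c"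
  define h where "h t = mills a c t + scaled_gauss_int c t" for t
  define h' where "h' t = exp (- c * t\<^sup>2) * ((c * t\<^sup>2 + a - 1 - c * t * sqrt (t\<^sup>2 + a / c))
      / (c * sqrt (t\<^sup>2 + a / c) * (t + sqrt (t\<^sup>2 + a / c))))" for t
  have der: "(h has_real_derivative h' t) (at t)" if "t > 0" for t
  proof -
    have "(h has_real_derivative exp (- c * t\<^sup>2) * ((c * t\<^sup>2 + a - 1 - c * t * sqrt (t\<^sup>2 + a / c))
      / (c * sqrt (t\<^sup>2 + a / c) * (t + sqrt (t\<^sup>2 + a / c))) - 1) + exp (- c * t\<^sup>2)) (at t)"
      unfolding h_def[abs_def] using assms that a
      by (intro DERIV_add mills_has_real_derivative scaled_gauss_int_has_real_derivative) auto
    then show ?thesis by (simp add: h'_def algebra_simps)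
  qed
  have cont: "continuous_on {u..v} h" if "u \<ge> 0" for u v
    unfolding h_def[abs_def] using assms a that
    by (intro continuous_intros continuous_on_subset[OF mills_continuous_on]
              continuous_on_subset[OF scaled_gauss_int_continuous_on]) auto
  \<comment> \<open>The sign of the numerator is read off from a difference of squares. As
    \<open>a < 2\<close>, that difference decreases in \<open>t\<close>, so the sign changes at most
    once, from plus to minus.\<close>
  have key: "(c * t\<^sup>2 + a - 1)\<^sup>2 - (c * t * sqrt (t\<^sup>2 + a / c))\<^sup>2 = (a - 1)\<^sup>2 - (2 - a) * (c * t\<^sup>2)" for t
  proof -
    have nn: "t\<^sup>2 + a / c \<ge> 0" using assms a by simp
    have "(c * t * sqrt (t\<^sup>2 + a / c))\<^sup>2 = c\<^sup>2 * t\<^sup>2 * (t\<^sup>2 + a / c)"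
      using nn by (simp add: power_mult_distrib)
    also have "\<dots> = (c * t\<^sup>2)\<^sup>2 + a * (c * t\<^sup>2)"
      using assms by (simp add: power2_eq_square algebra_simps)
    finally show ?thesis by (simp add: power2_eq_square algebra_simps)
  qed
  have den: "c * sqrt (t\<^sup>2 + a / c) * (t + sqrt (t\<^sup>2 + a / c)) \<ge> 0" if "t > 0" for t
    using assms a that by simp
  \<comment> \<open>\<open>h\<close> equals \<open>L\<close> at \<open>0\<close> and tends to \<open>L\<close> at infinity; it first increases and then decreases.\<close>
  have "h s \<ge> L"
  proof (cases "(2 - a) * (c * s\<^sup>2) \<le> (a - 1)\<^sup>2")
    case True
    have "h 0 \<le> h s"
    proof (rule DERIV_nonneg_imp_increasing_open[of 0 s h])
      fix t assume t: "0 < t" "t < s"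
      have "t\<^sup>2 \<le> s\<^sup>2" using t by (intro power_mono) auto
      then have "(2 - a) * (c * t\<^sup>2) \<le> (2 - a) * (c * s\<^sup>2)" using a assms by (intro mult_left_mono) auto
      then have "(c * t * sqrt (t\<^sup>2 + a / c))\<^sup>2 \<le> (c * t\<^sup>2 + a - 1)\<^sup>2" using True key[of t] by linarith
      moreover have "0 \<le> c * t\<^sup>2" using assms by simp
      then have "0 \<le> c * t\<^sup>2 + a - 1" using a by linarith
      ultimately have "c * t * sqrt (t\<^sup>2 + a / c) \<le> c * t\<^sup>2 + a - 1"
        by (rule power2_le_imp_le)
      then have "h' t \<ge> 0"
        unfolding h'_def using den[of t] t by (intro mult_nonneg_nonneg divide_nonneg_nonneg[OF _ den]) auto
      then show "\<exists>y. (h has_real_derivative y) (at t) \<and> y \<ge> 0" using der t by blast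
    qed (use assms cont in auto)
    moreover have "h 0 = L"
    proof -
      have "1 / (c * sqrt (a / c)) = sqrt pi / (2 * sqrt c)"
        using assms by (simp add: a_def real_sqrt_divide real_sqrt_mult field_simps)
      then show ?thesis using assms
        by (simp add: h_def mills_def scaled_gauss_int_def gauss_int_def L_def)
    qed
    ultimately show ?thesis by simp
  next
    case False
    have "(h \<longlongrightarrow> 0 + L) at_top"
      unfolding h_def[abs_def] L_def using assms a
      by (intro tendsto_add mills_tendsto scaled_gauss_int_tendsto) auto
    moreover have "\<forall>\<^sub>F T in at_top. h T \<le> h s"
      using eventually_ge_at_top[of s]
    proof eventually_elim
      case (elim T)
      show ?case
      proof (rule DERIV_nonpos_imp_decreasing_open[of s T h])
        fix t assume t: "s < t" "t < T"
        have "s\<^sup>2 \<le> t\<^sup>2" using t assms by (intro power_mono) auto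
        then have "(2 - a) * (c * s\<^sup>2) \<le> (2 - a) * (c * t\<^sup>2)" using a assms by (intro mult_left_mono) auto
        then have "(c * t\<^sup>2 + a - 1)\<^sup>2 \<le> (c * t * sqrt (t\<^sup>2 + a / c))\<^sup>2" using False key[of t] by linarith
        then have "c * t\<^sup>2 + a - 1 \<le> c * t * sqrt (t\<^sup>2 + a / c)"
          using a assms t by (rule_tac power2_le_imp_le) auto
        then have "h' t \<le> 0"
          unfolding h'_def using den[of t] t assms
          by (intro mult_nonneg_nonpos divide_nonpos_nonneg[OF _ den]) auto
        then show "\<exists>y. (h has_real_derivative y) (at t) \<and> y \<le> 0" using der[of t] t assms by auto
      qed (use elim assms cont in auto)
    qed
    ultimately show ?thesis using tendsto_upperbound[of h _ at_top "h s"] by simp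
  qed
  then show ?thesis by (simp add: h_def L_def a_def)
qed

subsection \<open>The bounds \<open>\<L>\<close> and \<open>\<U>\<close>\<close>

lemma scaled_gauss_int_mono:
  assumes "c > 0" "0 \<le> s" "s \<le> t"
  shows "scaled_gauss_int c s \<le> scaled_gauss_int c t"
proof (rule DERIV_nonneg_imp_increasing_open[OF assms(3)])
  show "continuous_on {s..t} (scaled_gauss_int c)"
    using assms by (intro continuous_on_subset[OF scaled_gauss_int_continuous_on]) auto
  show "\<exists>y. (scaled_gauss_int c has_real_derivative y) (at u) \<and> y \<ge> 0" if "s < u" for u
    using scaled_gauss_int_has_real_derivative[of c u] assms that by (auto intro: less_imp_le)
qed

section \<open>Elementary estimates for roots of quadratics\<close>

text \<open>Both sides are the positive root \<open>v\<close> of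
  \<open>v\<^sup>2 + s * v = x\<close>. Bounds for it thus reduce to testing the quadratic at a
  point.\<close>

lemma quadratic_root_eq:
  fixes s x :: real
  assumes "s > 0" "x > 0"
  shows "2 * x / (s + sqrt (s\<^sup>2 + 4 * x)) = (sqrt (s\<^sup>2 + 4 * x) - s) / 2"
proof -
  define r where "r = sqrt (s\<^sup>2 + 4 * x)"
  have "r\<^sup>2 = s\<^sup>2 + 4 * x" "r \<ge> 0" using assms by (simp_all add: r_def)
  then have "4 * x = (r - s) * (s + r)" "s + r > 0"
    using assms by (simp_all add: power2_eq_square algebra_simps)
  then have "2 * x / (s + r) = (r - s) / 2" by (simp add: divide_simps)
  then show ?thesis by (simp only: r_def)
qed

lemma quadratic_root_le:
  fixes s x v :: real
  assumes "s > 0" "x > 0" "v \<ge> 0" "x \<le> v\<^sup>2 + s * v"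
  shows "2 * x / (s + sqrt (s\<^sup>2 + 4 * x)) \<le> v"
proof -
  have "sqrt (s\<^sup>2 + 4 * x) \<le> s + 2 * v"
    using assms by (intro real_le_lsqrt) (auto simp: power2_eq_square algebra_simps)
  then show ?thesis using assms by (simp add: quadratic_root_eq)
qed

lemma quadratic_root_ge:
  fixes s x v :: real
  assumes "s > 0" "x > 0" "v\<^sup>2 + s * v \<le> x"
  shows "v \<le> 2 * x / (s + sqrt (s\<^sup>2 + 4 * x))"
proof -
  have "s + 2 * v \<le> sqrt (s\<^sup>2 + 4 * x)"
    using assms by (intro real_le_rsqrt) (auto simp: power2_eq_square algebra_simps)
  then show ?thesis using assms by (simp add: quadratic_root_eq)
qed

lemma bessel_F_ge_const:
  assumes "a > 0" "x > 0" "0 \<le> q" "q < 1" "2 * q * a \<le> (1 - q\<^sup>2) * x"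
  shows "q \<le> bessel_F a x"
proof -
  have qa: "q * a \<le> x"
  proof -
    have "(1 - q\<^sup>2) * x \<le> 1 * x" using assms by (intro mult_right_mono) auto
    then show ?thesis using assms mult_nonneg_nonneg[of q a] by linarith
  qed
  \<comment> \<open>The squares of the two sides differ by
    \<open>x * ((1 - q\<^sup>2) * x - 2 * q * a)\<close>; \<open>qa\<close> makes the right side
    nonnegative.\<close>
  have "q * sqrt (a\<^sup>2 + x\<^sup>2) \<le> x - q * a"
  proof (rule power2_le_imp_le)
    have "0 \<le> x * ((1 - q\<^sup>2) * x - 2 * q * a)" using assms by simp
    then show "(q * sqrt (a\<^sup>2 + x\<^sup>2))\<^sup>2 \<le> (x - q * a)\<^sup>2"
      by (simp add: power_mult_distrib power2_diff algebra_simps) (simp add: power2_eq_square algebra_simps)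
  qed (use qa in simp)
  moreover have "a + sqrt (a\<^sup>2 + x\<^sup>2) > 0" using assms by (intro add_pos_nonneg) auto
  ultimately show ?thesis by (simp add: bessel_F_def le_divide_eq algebra_simps)
qed

text \<open>
  With \<open>m = \<lfloor>x\<rfloor>\<close> and \<open>f\<close> the fractional part of \<open>\<nu>\<close>, the sum compared with an integral in \<open>lower_L\<close>
  ends at \<open>s = m + f + 1/2\<close>, whereas the subtracted term of \<open>lower_L\<close> is evaluated at \<open>m - f + 3/2\<close>
  and \<open>m + 3/2\<close>, which can make it too small. The deficit is paid for by keeping the last summand
  out of the comparison (so the comparison ends at \<open>m + f - 1/2\<close>) and by a third term of the
  tail. If \<open>x \<le> m + f + 1/2\<close> the left-hand side is already at most \<open>1\<close>; otherwise its excess is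
  at most \<open>\<epsilon> / (m + f + 3/2)\<close> with \<open>\<epsilon> = x - m - f - 1/2 \<le> 1/2\<close>.
\<close>

lemma lower_endpoint:
  fixes m f x :: real
  assumes m: "m \<ge> 2" and f: "0 \<le> f" "f < 1" and x: "m \<le> x" "x < m + 1"
  shows "2 * x / (m + f - 1/2 + sqrt ((m + f - 1/2)\<^sup>2 + 4 * x))
    \<le> 1 + bessel_F (m + f) x * bessel_F (m + f + 1) x * bessel_F (m + f + 2) x
      + exp (- ((1 - f) * (2 * m + 1) / x)) * (2 * x / (m + 3/2 + sqrt ((m + 3/2)\<^sup>2 + 8 * x / pi)))"
proof -
  define y where "y = m + f"
  define V where "V = 2 * x / (y - 1/2 + sqrt ((y - 1/2)\<^sup>2 + 4 * x))"
  define W where "W = 2 * x / (m + 3/2 + sqrt ((m + 3/2)\<^sup>2 + 8 * x / pi))"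
  define \<epsilon> where "\<epsilon> = x - y - 1/2"
  have y: "y \<ge> 2" using m f by (simp add: y_def)
  have xp: "x > 0" using m x by simp
  have F: "bessel_F y x \<ge> 0" "bessel_F (y + 1) x \<ge> 0" "bessel_F (y + 2) x \<ge> 0"
    using y xp by (auto intro!: bessel_F_nonneg)
  have W0: "W \<ge> 0" unfolding W_def using m xp by simp
  have "V \<le> 1 + bessel_F y x * bessel_F (y + 1) x * bessel_F (y + 2) x
        + exp (- ((1 - f) * (2 * m + 1) / x)) * W"
  proof (cases "\<epsilon> \<le> 0")
    case True
    have "V \<le> 1"
      unfolding V_def using y xp True by (intro quadratic_root_le) (auto simp: \<epsilon>_def)
    then show ?thesis
      using F W0 by (auto intro!: add_increasing2 mult_nonneg_nonneg)
  next
    case False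
    then have e: "\<epsilon> > 0" by simp
    have e2: "\<epsilon> \<le> 1/2" using x f by (simp add: \<epsilon>_def y_def)
    have V: "V \<le> 1 + \<epsilon> / (y + 3/2)"
      unfolding V_def
    proof (rule quadratic_root_le)
      \<comment> \<open>The quadratic at \<open>1 + d\<close> exceeds
        \<open>y + 1/2 + d * (y + 3/2)\<close> by \<open>d\<^sup>2\<close>, so
        \<open>d = \<epsilon> / (y + 3/2)\<close> already reaches \<open>x\<close>.\<close>
      have "(1 + d)\<^sup>2 + (y - 1/2) * (1 + d) = 1 + (y - 1/2) + d * (y + 3/2) + d\<^sup>2" for d
        by (simp add: power2_eq_square field_simps)
      moreover have "\<epsilon> / (y + 3/2) * (y + 3/2) = \<epsilon>" using y by simp
      ultimately show "x \<le> (1 + \<epsilon> / (y + 3/2))\<^sup>2 + (y - 1/2) * (1 + \<epsilon> / (y + 3/2))"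
        by (simp add: \<epsilon>_def)
    qed (use y e xp in auto)
    have W: "W \<ge> 6/10"
    proof -
      have "8 * x / pi \<le> 4 * x" using xp pi_ge_two by (simp add: divide_le_eq)
      then have "2 * x / (m + 3/2 + sqrt ((m + 3/2)\<^sup>2 + 4 * x)) \<le> W"
        unfolding W_def using m xp
        by (intro divide_left_mono add_left_mono real_sqrt_le_mono mult_pos_pos add_pos_nonneg) auto
      moreover have "6/10 \<le> 2 * x / (m + 3/2 + sqrt ((m + 3/2)\<^sup>2 + 4 * x))"
      proof (rule quadratic_root_ge)
        have "(6/10)\<^sup>2 + (m + 3/2) * (6/10) = 126/100 + 6/10 * m"
          by (simp add: power2_eq_square algebra_simps)
        then show "(6/10)\<^sup>2 + (m + 3/2) * (6/10) \<le> x"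
          using m e f by (simp add: \<epsilon>_def y_def)
      qed (use m xp in auto)
      ultimately show ?thesis by simp
    qed
    \<comment> \<open>The exponent is at least \<open>- 2 + 2 * \<epsilon> / x\<close>; then
      \<open>0.135 < exp (- 2)\<close> and \<open>1 + u \<le> exp u\<close> are used.\<close>
    have ex: "exp (- ((1 - f) * (2 * m + 1) / x)) \<ge> 135/1000 * (1 + 2 * \<epsilon> / x)"
    proof -
      have "(1 - f) * (2 * m + 1) \<le> 2 * x - 2 * \<epsilon>"
      proof -
        have "(1 - f) * (2 * m + 1) = 2 * m + 1 - f * (2 * m + 1)" by (simp add: algebra_simps)
        moreover have "f * (2 * m + 1) \<ge> 0" using f m by simp
        moreover have "2 * x - 2 * \<epsilon> = 2 * m + 2 * f + 1" by (simp add: \<epsilon>_def y_def)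
        ultimately show ?thesis using f by linarith
      qed
      then have "(1 - f) * (2 * m + 1) / x \<le> (2 * x - 2 * \<epsilon>) / x"
        using xp by (intro divide_right_mono) auto
      also have "\<dots> = 2 - 2 * \<epsilon> / x" using xp by (simp add: diff_divide_distrib)
      finally have "(1 - f) * (2 * m + 1) / x \<le> 2 - 2 * \<epsilon> / x" .
      then have "exp (- 2 + 2 * \<epsilon> / x) \<le> exp (- ((1 - f) * (2 * m + 1) / x))" by simp
      then have "exp (- 2) * exp (2 * \<epsilon> / x) \<le> exp (- ((1 - f) * (2 * m + 1) / x))"
        by (simp only: exp_add)
      moreover have "135/1000 * (1 + 2 * \<epsilon> / x) \<le> exp (- 2) * exp (2 * \<epsilon> / x)"
      proof (rule mult_mono)
        show "exp (- 2) \<ge> (135/1000 :: real)"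
        proof -
          have "exp (1::real) \<le> 2.719" using abs_le_D1[OF e_approx_32] by simp
          then have "exp (1::real) * exp 1 \<le> 2.719 * 2.719"
            by (intro mult_mono) auto
          then have "exp (2::real) \<le> 1000 / 135" by (simp add: exp_add[symmetric])
          then show ?thesis by (simp add: exp_minus field_simps)
        qed
        show "1 + 2 * \<epsilon> / x \<le> exp (2 * \<epsilon> / x)" by (rule exp_ge_add_one_self)
      qed (use e xp in auto)
      ultimately show ?thesis by (rule order_trans[rotated])
    qed
    \<comment> \<open>Here \<open>x > y + 1/2\<close> and \<open>y \<ge> 2\<close>. The constant
      0.41 is just below \<open>sqrt 2 - 1\<close>, the limit of \<open>bessel_F y (y + 1/2)\<close>
      for large \<open>y\<close>; 0.36 and 0.28 are just below the values of F at
      \<open>(3, 5/2)\<close> and \<open>(4, 5/2)\<close>, the case \<open>y = 2\<close>.\<close>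
    have "bessel_F y x \<ge> 41/100"
      by (rule bessel_F_ge_const) (use y xp e in \<open>auto simp: \<epsilon>_def power2_eq_square\<close>)
    moreover have "bessel_F (y + 1) x \<ge> 36/100"
      by (rule bessel_F_ge_const) (use y xp e in \<open>auto simp: \<epsilon>_def power2_eq_square\<close>)
    moreover have "bessel_F (y + 2) x \<ge> 28/100"
      by (rule bessel_F_ge_const) (use y xp e in \<open>auto simp: \<epsilon>_def power2_eq_square\<close>)
    ultimately have "41/100 * (36/100) * (28/100) \<le> bessel_F y x * bessel_F (y + 1) x * bessel_F (y + 2) x"
      by (intro mult_mono mult_nonneg_nonneg F) auto
    moreover have "135/1000 * (1 + 2 * \<epsilon> / x) * (6/10) \<le> exp (- ((1 - f) * (2 * m + 1) / x)) * W"
      using e xp by (intro mult_mono ex W) auto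
    \<comment> \<open>A share 0.162 of the left side is bounded through
      \<open>\<epsilon> / x\<close>, the other 0.838 through \<open>1/7\<close>; the constants on
      the right add up to more than \<open>0.838 / 7\<close>.\<close>
    moreover have "\<epsilon> / (y + 3/2) \<le> 41/100 * (36/100) * (28/100) + 135/1000 * (1 + 2 * \<epsilon> / x) * (6/10)"
    proof -
      have "\<epsilon> / (y + 3/2) \<le> \<epsilon> / x" using e e2 y xp by (intro divide_left_mono) (auto simp: \<epsilon>_def)
      moreover have "\<epsilon> / (y + 3/2) \<le> (1/2) / (7/2)" using e e2 y by (intro frac_le) auto
      ultimately show ?thesis by (simp add: field_simps) 
    qed
    ultimately show ?thesis using V by linarith
  qed
  then show ?thesis by (simp add: V_def W_def y_def add_ac)
qed

section \<open>Partial sums against Gaussians, and the two bounds\<close>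

text \<open>Completing the square, \<open>k * (2 * \<nu> + k + 1) = (\<nu> + k + 1/2)\<^sup>2 -
  (\<nu> + 1/2)\<^sup>2\<close>. Each term is compared with the unit interval to the right of its
  node, and the Mills differences telescope.\<close>

lemma bessel_P_sum_ge:
  assumes "\<nu> \<ge> 0" "x > 0"
  shows "exp ((\<nu> + 1/2)\<^sup>2 / (2 * x)) *
      (mills 2 (1 / (2 * x)) (\<nu> + 3/2) - mills 2 (1 / (2 * x)) (\<nu> + 3/2 + real n))
    \<le> (\<Sum>k<n. bessel_P \<nu> x (Suc k))"
proof (induction n)
  case (Suc n)
  let ?c = "1 / (2 * x)" and ?s = "\<nu> + 3/2 + real n"
  have "exp ((\<nu> + 1/2)\<^sup>2 / (2 * x)) * (mills 2 ?c ?s - mills 2 ?c (?s + 1))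
     \<le> exp ((\<nu> + 1/2)\<^sup>2 / (2 * x)) * exp (- ?c * ?s\<^sup>2)"
    using assms by (intro mult_left_mono mills_2_diff_le) auto
  also have "\<dots> = exp (- (real (Suc n) * (2 * \<nu> + real (Suc n) + 1)) / (2 * x))"
    unfolding exp_add[symmetric] using assms
    by (intro arg_cong[of _ _ exp]) (simp add: field_simps power2_eq_square)
  also have "\<dots> \<le> bessel_P \<nu> x (Suc n)" by (rule bessel_P_ge[OF assms])
  finally show ?case using Suc by (simp add: algebra_simps)
qed simp

text \<open>Here \<open>k * (2 * \<nu> + k) = (\<nu> + k)\<^sup>2 - \<nu>\<^sup>2\<close>, and each
  term is compared with the unit interval to the left of its node.\<close>

lemma bessel_P_sum_le:
  assumes "\<nu> \<ge> 0" "x > 0" "\<nu> + real n \<le> x + 1/2"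
  defines "c \<equiv> alpha0 / (2 * x)"
  shows "(\<Sum>k<n. bessel_P \<nu> x (Suc k))
    \<le> exp (c * \<nu>\<^sup>2) * (scaled_gauss_int c (\<nu> + real n) - scaled_gauss_int c \<nu>)"
  using assms(3)
proof (induction n)
  case (Suc n)
  have c: "c > 0" using assms alpha0_pos by (simp add: c_def)
  have "bessel_P \<nu> x (Suc n) \<le> exp (- c * (real (Suc n) * (2 * \<nu> + real (Suc n))))"
    unfolding c_def by (rule bessel_P_le[OF assms(1,2) Suc.prems])
  also have "\<dots> = exp (c * \<nu>\<^sup>2) * exp (- c * (\<nu> + real n + 1)\<^sup>2)"
    unfolding exp_add[symmetric]
    by (intro arg_cong[of _ _ exp]) (simp add: algebra_simps power2_eq_square)
  also have "\<dots> \<le> exp (c * \<nu>\<^sup>2) * (scaled_gauss_int c (\<nu> + real n + 1) - scaled_gauss_int c (\<nu> + real n))"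
    using assms c by (intro mult_left_mono scaled_gauss_int_diff_ge) auto
  finally show ?case using Suc by (simp add: algebra_simps)
qed simp

text \<open>The first \<open>j\<close> terms yield a Mills difference ending at \<open>s\<close>.
  The value at \<open>s\<close> is paid for by the next term, part of the tail and the subtracted
  term of \<open>lower_L\<close>, as \<open>lower_endpoint\<close> provides.\<close>

lemma lower_L_le_bessel_H:
  assumes nu: "\<nu> \<ge> 0" and x: "x > 0" and fl: "\<lfloor>\<nu>\<rfloor> + 2 \<le> \<lfloor>x\<rfloor>"
  shows "lower_L \<nu> x \<le> bessel_H \<nu> x"
proof -
  define m f where "m = real_of_int \<lfloor>x\<rfloor>" and "f = frac \<nu>"
  \<comment> \<open>One less than the number of terms before the tail, so that the last of them
    stays outside the comparison.\<close>
  define j where "j = nat (\<lfloor>x\<rfloor> - \<lfloor>\<nu>\<rfloor> - 2)"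
  have fl_nu: "real_of_int \<lfloor>\<nu>\<rfloor> = \<nu> - f" by (simp add: f_def frac_def)
  have j: "real j = m - (\<nu> - f) - 2" unfolding j_def m_def fl_nu[symmetric] using fl by simp
  have f: "0 \<le> f" "f < 1" by (simp_all add: f_def frac_lt_1)
  have "0 \<le> \<lfloor>\<nu>\<rfloor>" using nu by simp
  then have m: "m \<ge> 2" using fl unfolding m_def by linarith
  have xm: "m \<le> x" "x < m + 1" unfolding m_def by linarith+
  define c where "c = 1 / (2 * x)"
  define E where "E = exp ((\<nu> + 1/2)\<^sup>2 / (2 * x))"
  define e where "e = exp (- (real (Suc j) * (2 * \<nu> + real (Suc j) + 1)) / (2 * x))"
  define s where "s = m + f - 1/2"
  define \<mu> where "\<mu> = \<nu> + real (Suc j)"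
  have mu: "\<mu> = m + f - 1" "\<mu> \<ge> 0" using j nu by (simp_all add: \<mu>_def)
  define F1 F2 F3 where "F1 = bessel_F (m + f) x" and "F2 = bessel_F (m + f + 1) x"
    and "F3 = bessel_F (m + f + 2) x"
  define W where "W = 2 * x / (m + 3/2 + sqrt ((m + 3/2)\<^sup>2 + 8 * x / pi))"
  have mills_eq: "mills 2 c t = exp (- (t\<^sup>2 / (2 * x))) * (2 * x / (t + sqrt (t\<^sup>2 + 4 * x)))" for t
    using x by (simp add: mills_def c_def)
  have m_eq: "m = real j + \<nu> - f + 2" using j by simp
  \<comment> \<open>The lower bound for the term with index \<open>Suc j\<close> is the Gaussian at
    its node \<open>\<nu> + 1/2 + Suc j = s\<close>.\<close>
  have e_eq: "e = E * exp (- (s\<^sup>2 / (2 * x)))"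
    unfolding e_def E_def s_def exp_add[symmetric] using x
    by (intro arg_cong[of _ _ exp]) (simp add: m_eq field_simps power2_eq_square)
  have T1: "E * mills 2 c (\<nu> + 3/2)
     = 2 * x * exp (- (1 / x) * (\<nu> + 1)) / (\<nu> + 3/2 + sqrt ((\<nu> + 3/2)\<^sup>2 + 4 * x))"
  proof -
    have "E * exp (- ((\<nu> + 3/2)\<^sup>2 / (2 * x))) = exp (- (1 / x) * (\<nu> + 1))"
      unfolding E_def exp_add[symmetric] using x
      by (intro arg_cong[of _ _ exp]) (simp add: field_simps power2_eq_square)
    then show ?thesis by (simp add: mills_eq)
  qed
  \<comment> \<open>The exponents match because \<open>(m - f + 3/2)\<^sup>2 - (m + f - 1/2)\<^sup>2
    = 2 * (1 - f) * (2 * m + 1)\<close>.\<close>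
  have T2: "e * exp (- ((1 - f) * (2 * m + 1) / x)) * W =
     2 * x * exp (- (1 / (2 * x)) * (m - \<nu> - f + 1) * (m + \<nu> - f + 2)) / (m + 3/2 + sqrt ((m + 3/2)\<^sup>2 + 8 * x / pi))"
  proof -
    have "e * exp (- ((1 - f) * (2 * m + 1) / x)) = exp (- (1 / (2 * x)) * (m - \<nu> - f + 1) * (m + \<nu> - f + 2))"
      unfolding e_def exp_add[symmetric] using x
      by (intro arg_cong[of _ _ exp]) (simp add: m_eq field_simps power2_eq_square)
    then show ?thesis by (simp add: W_def)
  qed
  have T3: "e = exp (- ((m - (\<nu> - f) - 1) * (m + \<nu> + f)) / (2 * x))"
    unfolding e_def by (intro arg_cong[of _ _ exp]) (simp add: m_eq algebra_simps)
  have "E * mills 2 c s = e * (2 * x / (s + sqrt (s\<^sup>2 + 4 * x)))"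
    by (simp add: mills_eq e_eq)
  also have "\<dots> \<le> e * (1 + F1 * F2 * F3 + exp (- ((1 - f) * (2 * m + 1) / x)) * W)"
    unfolding s_def F1_def F2_def F3_def W_def
    by (intro mult_left_mono lower_endpoint m f xm) (simp add: e_def)
  finally have endpoint: "E * mills 2 c s \<le> e + e * F1 * F2 * F3 + e * exp (- ((1 - f) * (2 * m + 1) / x)) * W"
    by (simp add: algebra_simps)
  have "F1 * (1 + F2 * (1 + F3)) \<le> bessel_H \<mu> x"
    using bessel_H_ge[OF mu(2) x] by (simp add: mu(1) F1_def F2_def F3_def add_ac)
  moreover have "bessel_H \<mu> x \<ge> 0" by (rule bessel_H_nonneg[OF mu(2) x])
  moreover have "e \<le> bessel_P \<nu> x (Suc j)" unfolding e_def by (rule bessel_P_ge[OF nu x])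
  ultimately have "e * (1 + F1 * (1 + F2 * (1 + F3))) \<le> bessel_P \<nu> x (Suc j) * (1 + bessel_H \<mu> x)"
    using bessel_P_pos[OF nu x, of "Suc j"] F1_def F2_def F3_def m f x
    by (intro mult_mono add_left_mono) (auto intro!: add_nonneg_nonneg mult_nonneg_nonneg bessel_F_nonneg)
  moreover have "E * (mills 2 c (\<nu> + 3/2) - mills 2 c s) \<le> (\<Sum>k<j. bessel_P \<nu> x (Suc k))"
  proof -
    have "s = \<nu> + 3/2 + real j" by (simp add: s_def j)
    then show ?thesis using bessel_P_sum_ge[OF nu x, of j] by (simp only: E_def c_def)
  qed
  moreover have "bessel_H \<nu> x = (\<Sum>k<j. bessel_P \<nu> x (Suc k)) + bessel_P \<nu> x (Suc j) * (1 + bessel_H \<mu> x)"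
    using bessel_H_split[OF nu x, of "Suc j"] by (simp add: \<mu>_def algebra_simps)
  \<comment> \<open>Inserting \<open>endpoint\<close> cancels \<open>e\<close> and
    \<open>e * F1 * F2 * F3\<close>; of the tail bound exactly the last term of
    \<open>lower_L\<close> survives.\<close>
  ultimately have "E * mills 2 c (\<nu> + 3/2) - e * exp (- ((1 - f) * (2 * m + 1) / x)) * W + e * F1 * (1 + F2)
    \<le> bessel_H \<nu> x"
    using endpoint by (simp add: algebra_simps)
  then show ?thesis
    unfolding T1 T2 unfolding lower_L_def T3 F1_def F2_def fl_nu m_def[symmetric] f_def[symmetric] .
qed

text \<open>The partial sum is below a Gaussian integral over \<open>[\<nu>, \<mu>]\<close>,
  enlarged to \<open>[\<nu>, x]\<close> as \<open>\<mu> \<le> x\<close>. That integral is the tail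
  from \<open>\<nu>\<close> minus the tail from \<open>x\<close>, bounded by the upper and the lower
  Mills approximation respectively.\<close>

lemma bessel_H_le_upper_U:
  assumes nu: "\<nu> \<ge> 0" and x: "x > 0" and fl: "\<lfloor>\<nu>\<rfloor> + 2 \<le> \<lfloor>x\<rfloor>"
  shows "bessel_H \<nu> x \<le> upper_U \<nu> x"
proof -
  define m f where "m = real_of_int \<lfloor>x\<rfloor>" and "f = frac \<nu>"
  define n where "n = nat (\<lfloor>x\<rfloor> - \<lfloor>\<nu>\<rfloor> - 1)"
  have fl_nu: "real_of_int \<lfloor>\<nu>\<rfloor> = \<nu> - f" by (simp add: f_def frac_def)
  have n: "real n = m - (\<nu> - f) - 1" unfolding n_def m_def fl_nu[symmetric] using fl by simp
  have f: "0 \<le> f" "f < 1" by (simp_all add: f_def frac_lt_1)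
  have xm: "m \<le> x" unfolding m_def by linarith
  define c where "c = alpha0 / (2 * x)"
  have c: "c > 0" using alpha0_pos x by (simp add: c_def)
  define \<mu> where "\<mu> = \<nu> + real n"
  have mu: "\<mu> = m + f - 1" "\<mu> \<ge> 0" "\<mu> \<le> x" using n nu xm f by (simp_all add: \<mu>_def)
  define B where "B = bessel_F (m + f - 1/2) x / (1 - bessel_F (m + f + 1/2) x)"
  have "\<mu> \<le> x + 1/2" using mu by simp
  note mu' = this[unfolded \<mu>_def]
  have "(\<Sum>k<n. bessel_P \<nu> x (Suc k)) \<le> exp (c * \<nu>\<^sup>2) * (scaled_gauss_int c \<mu> - scaled_gauss_int c \<nu>)"
    using bessel_P_sum_le[OF nu x mu'] by (simp add: c_def \<mu>_def)
  also have "\<dots> \<le> exp (c * \<nu>\<^sup>2) * (mills (4 / pi) c \<nu> - mills 2 c x)"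
    using scaled_gauss_int_mono[OF c mu(2,3)] mills_2_lower[OF c, of x] mills_4_over_pi_upper[OF c nu] x
    by (intro mult_left_mono) auto
  also have "\<dots> = 2 * x / alpha0 *
       (1 / (\<nu> + sqrt (\<nu>\<^sup>2 + 8 * x / (pi * alpha0)))
        - exp (- (alpha0 / (2 * x)) * (x\<^sup>2 - \<nu>\<^sup>2)) / (x + sqrt (x\<^sup>2 + 4 * x / alpha0)))"
  proof -
    have c1: "1 / c = 2 * x / alpha0" "4 / pi / c = 8 * x / (pi * alpha0)" "2 / c = 4 * x / alpha0"
      by (simp_all add: c_def)
    have e1: "exp (c * \<nu>\<^sup>2) * exp (- c * \<nu>\<^sup>2) = 1" by (simp add: exp_minus)
    have e2: "exp (c * \<nu>\<^sup>2) * exp (- c * x\<^sup>2) = exp (- c * (x\<^sup>2 - \<nu>\<^sup>2))"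
      unfolding exp_add[symmetric] by (intro arg_cong[of _ _ exp]) (simp add: algebra_simps)
    have "exp (c * \<nu>\<^sup>2) * (mills (4 / pi) c \<nu> - mills 2 c x) =
       1 / c * (exp (c * \<nu>\<^sup>2) * exp (- c * \<nu>\<^sup>2) / (\<nu> + sqrt (\<nu>\<^sup>2 + 4 / pi / c))
         - exp (c * \<nu>\<^sup>2) * exp (- c * x\<^sup>2) / (x + sqrt (x\<^sup>2 + 2 / c)))"
      by (simp add: mills_def right_diff_distrib)
    then show ?thesis unfolding e1 e2 c1 by (simp only: c_def)
  qed
  finally have part1: "(\<Sum>k<n. bessel_P \<nu> x (Suc k)) \<le> \<dots>" .
  have "bessel_P \<nu> x n \<le> exp (- (alpha0 / (2 * x)) * (real n * (2 * \<nu> + real n)))"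
    by (rule bessel_P_le[OF nu x mu'])
  also have "\<dots> = exp (- (alpha0 / (2 * x)) * (m - (\<nu> - f) - 1) * (m + \<nu> + f - 1))"
    unfolding n using x by (intro arg_cong[of _ _ exp]) (simp add: field_simps)
  finally have "bessel_P \<nu> x n \<le> \<dots>" .
  moreover have "bessel_H \<mu> x \<le> B"
    using bessel_H_le[OF mu(2) x] by (simp add: B_def mu(1) algebra_simps)
  ultimately have "bessel_P \<nu> x n * bessel_H \<mu> x
     \<le> exp (- (alpha0 / (2 * x)) * (m - (\<nu> - f) - 1) * (m + \<nu> + f - 1)) * B"
    by (intro mult_mono bessel_H_nonneg[OF mu(2) x]) auto
  with part1 have "bessel_H \<nu> x \<le> 2 * x / alpha0 *
       (1 / (\<nu> + sqrt (\<nu>\<^sup>2 + 8 * x / (pi * alpha0)))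
        - exp (- (alpha0 / (2 * x)) * (x\<^sup>2 - \<nu>\<^sup>2)) / (x + sqrt (x\<^sup>2 + 4 * x / alpha0)))
      + exp (- (alpha0 / (2 * x)) * (m - (\<nu> - f) - 1) * (m + \<nu> + f - 1)) * B"
    using bessel_H_split[OF nu x, of n] by (simp only: \<mu>_def add_mono)
  then show ?thesis
    unfolding upper_U_def B_def fl_nu m_def[symmetric] f_def[symmetric] .
qed

theorem theorem1:
  fixes \<nu> x :: real
  assumes "\<nu> \<ge> 0" and "x \<ge> 0" and "bessel_I \<nu> x \<noteq> 0"
  shows "(bessel_F (\<nu> + 1) x * (1 + bessel_F (\<nu> + 2) x) \<le> bessel_H \<nu> x \<and>
          bessel_H \<nu> x \<le> bessel_F (\<nu> + 1/2) x / (1 - bessel_F (\<nu> + 3/2) x)) \<and>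
         (\<lfloor>\<nu>\<rfloor> + 2 \<le> \<lfloor>x\<rfloor> \<longrightarrow> lower_L \<nu> x \<le> bessel_H \<nu> x \<and> bessel_H \<nu> x \<le> upper_U \<nu> x)"
proof (cases "x = 0")
  case True
  \<comment> \<open>At the origin every numerator of H has positive order and vanishes. F vanishes
    there too, and the condition of part (2) fails.\<close>
  have "bessel_I (\<nu> + real (Suc k)) 0 = 0" for k using assms(1) by (intro bessel_I_zero) simp
  then have "bessel_H \<nu> x = 0" by (simp add: bessel_H_def True del: of_nat_Suc)
  moreover have "\<not> \<lfloor>\<nu>\<rfloor> + 2 \<le> \<lfloor>x\<rfloor>"
  proof -
    have "0 \<le> \<lfloor>\<nu>\<rfloor>" using assms(1) by simp
    moreover have "\<lfloor>x\<rfloor> = 0" using True by simp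
    ultimately show ?thesis by linarith
  qed
  ultimately show ?thesis by (simp add: True bessel_F_def)
next
  case False
  then have x: "x > 0" using assms(2) by simp
  have F: "bessel_F (\<nu> + 1) x \<ge> 0" "bessel_F (\<nu> + 2) x \<ge> 0" "bessel_F (\<nu> + 3) x \<ge> 0"
    using assms(1) x by (auto intro!: bessel_F_nonneg)
  have "bessel_F (\<nu> + 1) x * (1 + bessel_F (\<nu> + 2) x)
      \<le> bessel_F (\<nu> + 1) x * (1 + bessel_F (\<nu> + 2) x * (1 + bessel_F (\<nu> + 3) x))"
    using F by (intro mult_left_mono add_left_mono) (auto simp: algebra_simps)
  also have "\<dots> \<le> bessel_H \<nu> x" by (rule bessel_H_ge[OF assms(1) x])
  finally show ?thesis
    using bessel_H_le[OF assms(1) x] lower_L_le_bessel_H[OF assms(1) x] bessel_H_le_upper_U[OF assms(1) x]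
    by blast
qed

end
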